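(* Let $\mathcal{D}=\{X\in\mathbb{R}^{n\times p}:\ \operatorname{rank}(X)\le k,\ f(\lambda(X))\le 0\}$, where $\lambda(X)$ is the vector of singular values of $X$, and let $\tilde k\le k$ be its strengthened rank. Consider $$V_{\rm rel}:=\min_{X\in \operatorname{conv}(\mathcal{D})}\{\langle A_0,X\rangle:\ b_i^l\le\langle A_i,X\rangle\le b_i^u,\ \forall i\in[m]\}\qquad\text{(LSOP-R)},$$ let $\tilde m$ be the number of linearly independent matrices among $A_1,\dots,A_m$, and suppose that the feasible set of LSOP-R contains no line. Then: (i) every extreme point of the feasible set of LSOP-R has rank at most $\tilde k+\lfloor\sqrt{2\tilde m+9/4}-3/2\rfloor$; and (ii) there is an optimal solution to LSOP-R of rank at most $\tilde k+\lfloor\sqrt{2\tilde m+9/4}-3/2\rfloor$ if LSOP-R yields a finite optimal value, i.e., $V_{\rm rel}>-\infty$.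
   Context: $k\le n\le p$ are positive integers; $[m]=\{1,\dots,m\}$; $\langle\cdot,\cdot\rangle$ is the Frobenius inner product; $\operatorname{conv}$ denotes convex hull. For $X\in\mathbb{R}^{n\times p}$, $\lambda(X)\in\mathbb{R}_+^n$ is the vector of its $n$ singular values. The function $f:\mathbb{R}^n\to\mathbb{R}$ is continuous, convex, symmetric (invariant under permutations of its arguments) and, since singular values are nonnegative, is taken to be sign-invariant ($f(\lambda)=f(|\lambda|)$ with $|\cdot|$ entrywise); thus $F(X):=f(\lambda(X))$ is a continuous convex function on $\mathbb{R}^{n\times p}$. $A_0,A_1,\dots,A_m\in\mathbb{R}^{n\times p}$ and $-\infty\le b_i^l\le b_i^u\le+\infty$. The number $\tilde m$ is the dimension of the linear span of $\{A_i\}_{i\in[m]}$. Strengthened rank: $\tilde k$ with $1\le\tilde k\le k$ is the smallest integer such that $\operatorname{conv}(\mathcal{D})=\operatorname{conv}(\{X\in\mathbb{R}^{n\times p}:\ \operatorname{rank}(X)\le\tilde k,\ f(\lambda(X))\le0\})$. *)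

theory Defs
  imports "HOL-Analysis.Analysis"
begin

(* A real n x p matrix has type real^'p^'n, and the inner product of that Euclidean space,
   A \<bullet> B = (\<Sum>i j. A_ij * B_ij), is the Frobenius inner product. *)

(* The n singular values of X (for n \<le> p) are the square roots of the eigenvalues of X X^T,
   repeated according to algebraic multiplicity: s is nonnegative and the characteristic
   polynomial of X X^T is the product of the factors t - s_i^2. *)
definition is_singular_values :: "real^'p^'n \<Rightarrow> real^'n \<Rightarrow> bool" where
  "is_singular_values X s \<longleftrightarrow>
     (\<forall>i. 0 \<le> s $ i) \<and>
     (\<forall>t::real. det (mat t - X ** transpose X) = (\<Prod>i\<in>UNIV. t - (s $ i)\<^sup>2))"

(* The condition determines s only up to a permutation of its entries. The index type 'n carries
   no order, so an arbitrary arrangement is chosen; the arrangement is irrelevant when a symmetric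
   function is applied to the vector. *)
definition singular_values :: "real^'p^'n \<Rightarrow> real^'n" where
  "singular_values X = (SOME s. is_singular_values X s)"

definition symmetric_fun :: "(real^'n \<Rightarrow> real) \<Rightarrow> bool" where
  "symmetric_fun f \<longleftrightarrow> (\<forall>\<pi> x. \<pi> permutes UNIV \<longrightarrow> f (\<chi> i. x $ \<pi> i) = f x)"

definition sign_invariant :: "(real^'n \<Rightarrow> real) \<Rightarrow> bool" where
  "sign_invariant f \<longleftrightarrow> (\<forall>x. f x = f (\<chi> i. \<bar>x $ i\<bar>))"

definition domain_set :: "(real^'n \<Rightarrow> real) \<Rightarrow> nat \<Rightarrow> (real^'p^'n) set" where
  "domain_set f k = {X. rank X \<le> k \<and> f (singular_values X) \<le> 0}"

(* The argument TYPE('p) fixes the number of columns, which is not visible in the other types. *)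
definition strengthened_rank :: "'p::finite itself \<Rightarrow> (real^'n \<Rightarrow> real) \<Rightarrow> nat \<Rightarrow> nat" where
  "strengthened_rank _ f k =
     (LEAST r. 1 \<le> r \<and> r \<le> k \<and>
        convex hull (domain_set f k :: (real^'p^'n) set) = convex hull (domain_set f r))"

definition lsopr_feasible ::
  "(real^'n \<Rightarrow> real) \<Rightarrow> nat \<Rightarrow> nat \<Rightarrow> (nat \<Rightarrow> real^'p^'n) \<Rightarrow> (nat \<Rightarrow> ereal) \<Rightarrow> (nat \<Rightarrow> ereal) \<Rightarrow>
     (real^'p^'n) set" where
  "lsopr_feasible f k m A bl bu =
     {X \<in> convex hull (domain_set f k).
        \<forall>i\<in>{1..m}. bl i \<le> ereal (A i \<bullet> X) \<and> ereal (A i \<bullet> X) \<le> bu i}"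

(* The value is \<infinity> on an empty feasible set. *)
definition lsopr_value ::
  "(real^'n \<Rightarrow> real) \<Rightarrow> nat \<Rightarrow> nat \<Rightarrow> (nat \<Rightarrow> real^'p^'n) \<Rightarrow> (nat \<Rightarrow> ereal) \<Rightarrow> (nat \<Rightarrow> ereal) \<Rightarrow>
     ereal" where
  "lsopr_value f k m A bl bu = (INF X\<in>lsopr_feasible f k m A bl bu. ereal (A 0 \<bullet> X))"

definition lsopr_optimal ::
  "(real^'n \<Rightarrow> real) \<Rightarrow> nat \<Rightarrow> nat \<Rightarrow> (nat \<Rightarrow> real^'p^'n) \<Rightarrow> (nat \<Rightarrow> ereal) \<Rightarrow> (nat \<Rightarrow> ereal) \<Rightarrow>
     real^'p^'n \<Rightarrow> bool" where
  "lsopr_optimal f k m A bl bu =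
     is_arg_min (\<lambda>X. A 0 \<bullet> X) (\<lambda>X. X \<in> lsopr_feasible f k m A bl bu)"

definition contains_line :: "'a::real_vector set \<Rightarrow> bool" where
  "contains_line S \<longleftrightarrow> (\<exists>x d. d \<noteq> 0 \<and> (\<forall>t::real. x + t *\<^sub>R d \<in> S))"

end

theory Submission
  imports Defs
begin

text \<open>
  Let \<open>K\<close> be the convex hull of the domain set. The strengthened rank \<open>k'\<close> yields the same hull, so
  \<open>K\<close> may be taken to be generated by matrices of rank at most \<open>k'\<close>.

  An extreme point \<open>X\<close> of the feasible set admits no nonzero direction that is orthogonal to all
  \<open>A i\<close> and along which one can move a little both ways inside \<open>K\<close>, for the side constraints only
  see the numbers \<open>A i \<bullet> X\<close>. As the two-sided directions of \<open>K\<close> at \<open>X\<close> form a subspace, its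
  dimension is at most \<open>mt\<close> (\<open>dim_two_sided_directions_le\<close>). The rank bound therefore says that a
  matrix in \<open>K\<close> of large rank has many two-sided directions: if its rank is \<open>k' + s\<close> with \<open>s > 0\<close>,
  there are at least \<open>(s + 1) (s + 2) / 2 - 1\<close> independent ones, the dimension of the space of
  symmetric traceless matrices of order \<open>s + 1\<close>. Solving \<open>s (s + 3) \<le> 2 mt\<close> for \<open>s\<close> gives the
  bound of the theorem.

  These directions come from a description of \<open>K\<close> by majorization (\<open>convex_hull_domain_set\<close>): \<open>X\<close>
  lies in \<open>K\<close> iff there is a nonnegative decreasing vector \<open>x\<close> with \<open>f x \<le> 0\<close>, zero beyond the first
  \<open>k'\<close> entries, such that for every \<open>l\<close> the Ky Fan norm of \<open>X\<close> of order \<open>l\<close> (the sum of its \<open>l\<close>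
  largest singular values) is at most the sum of the first \<open>l\<close> entries of \<open>x\<close>. Necessity holds since
  vectors \<open>x\<close> can be averaged along with the matrices. Sufficiency is proved by separation: a linear
  functional \<open>C\<close> is bounded on \<open>X\<close> by applying the Ky Fan inequalities to the singular vectors of
  \<open>C\<close> and summing by parts.

  Suppose now that the rank \<open>r\<close> of \<open>X\<close> exceeds \<open>k'\<close>, and let \<open>s\<^sub>1 \<ge> s\<^sub>2 \<ge> \<dots>\<close> be its singular
  values. The partial sums of \<open>x\<close> are constant from \<open>k'\<close> on while those of the \<open>s\<^sub>i\<close> increase strictly
  up to \<open>r\<close>, so the Ky Fan inequalities of orders \<open>k'\<close>, ..., \<open>r - 1\<close> are strict. Let \<open>j < k'\<close> be the
  last tight order below \<open>r\<close>. Then \<open>s\<^sub>j > s\<^bsub>j+1\<^esub>\<close>, and adding to the block of the singular values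
  \<open>j + 1\<close>, ..., \<open>r\<close> a small symmetric matrix of trace zero affects neither the \<open>j\<close> leading singular
  values nor the total sum, whereas the orders in between have room to spare. The block has at least
  \<open>s + 1\<close> rows. It is enough to check the perturbations that change two diagonal entries or
  one symmetric pair of off-diagonal entries (\<open>perturbation_block\<close>), because these span all of them.

  For the existence of an optimal solution of low rank, note that the sublevel set of \<open>f\<close> is convex and
  invariant under permutations and changes of sign, hence it is bounded or the whole space. If it is bounded,
  \<open>K\<close> is compact, and the optimal face of the feasible set has an extreme point, to which the first
  part applies. If it is the whole space, so is \<open>K\<close>: the problem is a linear program, whose finite
  value is attained; absence of lines then forces the \<open>A i\<close> to span the whole space, and the bound is
  at least the number of rows.
\<close>

section \<open>Enumerating a finite index type\<close>

text \<open>
  The rows carry no order, but partial sums of singular values need one. The index type is therefore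
  numbered from \<open>0\<close> once and for all, and every order on it below refers to this numbering.
\<close>
definition pos :: "'a::finite \<Rightarrow> nat" where
  "pos = (SOME h. bij_betw h UNIV {..<CARD('a)})"

lemma bij_pos: "bij_betw (pos :: 'a::finite \<Rightarrow> nat) UNIV {..<CARD('a)}"
proof -
  have "\<exists>h. bij_betw h (UNIV :: 'a set) {0..<CARD('a)}"
    by (rule ex_bij_betw_finite_nat) simp
  then have "\<exists>h. bij_betw h (UNIV :: 'a set) {..<CARD('a)}"
    by (simp add: atLeast0LessThan)
  then show ?thesis
    unfolding pos_def by (rule someI_ex)
qed

lemma pos_less: "pos (i::'a::finite) < CARD('a)"
  using bij_pos[where 'a='a] by (auto simp: bij_betw_def)

lemma pos_inject [simp]: "pos (i::'a::finite) = pos j \<longleftrightarrow> i = j"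
  using bij_pos[where 'a='a] by (auto simp: bij_betw_def inj_on_def)

lemma pos_surj: "l < CARD('a) \<Longrightarrow> \<exists>i::'a::finite. pos i = l"
  using bij_pos[where 'a='a] by (metis bij_betw_def imageE lessThan_iff)

lemma sum_pos_nat:
  assumes "l \<le> CARD('a)"
  shows "(\<Sum>i::'a::finite | pos i < l. g (pos i)) = (\<Sum>q<l. g q)"
proof (rule sum.reindex_bij_betw)
  have "q \<in> pos ` {i::'a. pos i < l}" if "q < l" for q
    using pos_surj[of q, where 'a='a] that assms by auto
  then show "bij_betw pos {i::'a. pos i < l} {..<l}"
    by (auto simp: bij_betw_def inj_on_def)
qed

lemma card_pos_less:
  assumes "l \<le> CARD('a)"
  shows "card {i::'a::finite. pos i < l} = l"
  using sum_pos_nat[OF assms, of "\<lambda>_. 1::nat"] by simp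

lemma pos_less_Suc:
  assumes "pos (i::'a::finite) = l"
  shows "{q::'a. pos q < Suc l} = insert i {q. pos q < l}"
  using assms by (auto simp: less_Suc_eq)

lemma pos_less_all: "CARD('a) \<le> l \<Longrightarrow> {i::'a::finite. pos i < l} = UNIV"
  using pos_less order_less_le_trans by blast

section \<open>Outer products and orthonormal systems\<close>

definition outer :: "real^'n \<Rightarrow> real^'p \<Rightarrow> real^'p^'n" where
  "outer a b = (\<chi> i j. a $ i * b $ j)"

lemma inner_outer: "outer a b \<bullet> X = a \<bullet> (X *v b)"
  by (simp add: outer_def inner_vec_def matrix_vector_mult_def sum_distrib_left mult_ac)

lemma outer_mult: "outer a b *v w = (b \<bullet> w) *\<^sub>R a"
  by (simp add: outer_def vec_eq_iff inner_vec_def matrix_vector_mult_def sum_distrib_left mult_ac)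

lemma inner_outer_outer: "outer a b \<bullet> outer c d = (a \<bullet> c) * (b \<bullet> d)"
  by (simp add: inner_outer outer_mult inner_commute)

lemma outer_add_left: "outer (a + b) c = outer a c + outer b c"
  and outer_add_right: "outer a (c + d) = outer a c + outer a d"
  and outer_scaleR_left: "outer (t *\<^sub>R a) c = t *\<^sub>R outer a c"
  and outer_scaleR_right: "outer a (t *\<^sub>R c) = t *\<^sub>R outer a c"
  by (simp_all add: outer_def vec_eq_iff algebra_simps)

definition orthonormal_rows :: "real^'m^'n \<Rightarrow> bool" where
  "orthonormal_rows U \<longleftrightarrow> (\<forall>i j. U $ i \<bullet> U $ j = (if i = j then 1 else 0))"

lemma orthonormal_rowsD: "orthonormal_rows U \<Longrightarrow> U $ i \<bullet> U $ j = (if i = j then 1 else 0)"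
  by (simp add: orthonormal_rows_def)

text \<open>
  Bessel's inequality: the squared distance of \<open>y\<close> from its projection onto the selected rows is
  nonnegative.
\<close>
lemma bessel:
  assumes "orthonormal_rows P"
  shows "(\<Sum>i\<in>I. (P $ i \<bullet> y)\<^sup>2) \<le> y \<bullet> y"
proof -
  define z where "z = (\<Sum>i\<in>I. (P $ i \<bullet> y) *\<^sub>R P $ i)"
  have fin: "finite I" by simp
  have zz: "z \<bullet> z = (\<Sum>i\<in>I. (P $ i \<bullet> y)\<^sup>2)"
    unfolding z_def using fin
    by (simp add: inner_sum_left inner_sum_right orthonormal_rowsD[OF assms] power2_eq_square
        if_distrib[of "\<lambda>t. _ * t"] sum.delta cong: if_cong)
  have zy: "z \<bullet> y = (\<Sum>i\<in>I. (P $ i \<bullet> y)\<^sup>2)"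
    unfolding z_def by (simp add: inner_sum_left power2_eq_square)
  have "0 \<le> (y - z) \<bullet> (y - z)" by simp
  also have "\<dots> = y \<bullet> y - 2 * (z \<bullet> y) + z \<bullet> z"
    by (simp add: inner_diff_left inner_diff_right inner_commute)
  finally show ?thesis using zz zy by simp
qed

section \<open>Matrices in singular form\<close>

text \<open>
  Neither signs nor order are imposed on \<open>x\<close>: if \<open>U\<close> and \<open>V\<close> have orthonormal rows, the singular values
  are the absolute values of the entries of \<open>x\<close> in some order.
\<close>
definition spectral_sum :: "real^'n \<Rightarrow> real^'n^'n \<Rightarrow> real^'p^'n \<Rightarrow> real^'p^'n" where
  "spectral_sum x U V = (\<Sum>i\<in>UNIV. x $ i *\<^sub>R outer (U $ i) (V $ i))"

lemma spectral_sum_mult: "spectral_sum x U V *v w = (\<Sum>i\<in>UNIV. (x $ i * (V $ i \<bullet> w)) *\<^sub>R U $ i)"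
proof -
  have "sum g I *v w = (\<Sum>i\<in>I. g i *v w)" for g :: "'a \<Rightarrow> real^'b^'a" and I
    by (induction I rule: infinite_finite_induct) (auto simp: matrix_vector_mult_add_rdistrib)
  then show ?thesis
    unfolding spectral_sum_def by (simp add: scaleR_matrix_vector_assoc[symmetric] outer_mult)
qed

lemma spectral_sum_eq_mat:
  "spectral_sum x U V = transpose U ** (\<chi> i j. if i = j then x $ i else 0) ** V"
  by (simp add: spectral_sum_def vec_eq_iff outer_def transpose_def matrix_matrix_mult_def
      if_distrib[of "\<lambda>t. _ * t"] cong: if_cong) (simp add: mult_ac)

lemma orthonormal_rows_iff: "orthonormal_rows U \<longleftrightarrow> U ** transpose U = mat 1"
  by (simp add: orthonormal_rows_def vec_eq_iff matrix_matrix_mult_def transpose_def mat_def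
      inner_vec_def)

text \<open>
  With \<open>D\<close> the diagonal matrix of \<open>x\<close>, the product of the matrix with its transpose is
  \<open>U\<^sup>T D\<^sup>2 U\<close>, which is similar to \<open>D\<^sup>2\<close> because \<open>U\<close> is orthogonal.
\<close>
lemma det_spectral_sum:
  fixes U :: "real^'n^'n" and V :: "real^'p^'n"
  assumes U: "orthonormal_rows U" and V: "orthonormal_rows V"
  shows "det (mat t - spectral_sum x U V ** transpose (spectral_sum x U V)) =
    (\<Prod>i\<in>UNIV. t - (x $ i)\<^sup>2)"
proof -
  define D where "D = (\<chi> i j. if i = j then x $ i else 0 :: real^'n^'n)"
  define E where "E = (\<chi> i j. if i = j then t - (x $ i)\<^sup>2 else 0 :: real^'n^'n)"
  define X where "X = spectral_sum x U V"
  have UU: "U ** transpose U = mat 1" and VV: "V ** transpose V = mat 1"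
    using U V by (simp_all add: orthonormal_rows_iff)
  have UU': "transpose U ** U = mat 1"
    using UU matrix_left_right_inverse by blast
  have X: "X = transpose U ** D ** V"
    unfolding X_def D_def by (rule spectral_sum_eq_mat)
  have tD: "transpose D = D" unfolding D_def by (auto simp: vec_eq_iff transpose_def)
  have "X ** transpose X = transpose U ** D ** (V ** transpose V) ** transpose D ** U"
    unfolding X by (simp add: matrix_transpose_mul matrix_mul_assoc)
  also have "\<dots> = transpose U ** (D ** D) ** U"
    by (simp add: VV tD matrix_mul_assoc)
  finally have XX: "X ** transpose X = transpose U ** (D ** D) ** U" .
  have E: "E = mat t - D ** D"
    unfolding E_def D_def
    by (simp add: vec_eq_iff mat_def matrix_matrix_mult_def power2_eq_square
        if_distrib[of "\<lambda>t. _ * t"] cong: if_cong)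
  have mt: "mat t = t *\<^sub>R (mat 1 :: real^'n^'n)"
    by (simp add: vec_eq_iff mat_def)
  have "transpose U ** E ** U = t *\<^sub>R (transpose U ** U) - transpose U ** (D ** D) ** U"
    unfolding E mt matrix_eq
    by (simp add: matrix_vector_mul_assoc[symmetric] matrix_vector_mult_diff_rdistrib
        matrix_vector_mult_diff_distrib matrix_vector_mult_scaleR
        scaleR_matrix_vector_assoc[symmetric])
  also have "\<dots> = mat t - X ** transpose X"
    by (simp add: UU' XX mt)
  finally have "det (mat t - X ** transpose X) = det (transpose U) * det E * det U"
    by (metis det_mul)
  also have "\<dots> = det (transpose U ** U) * det E" by (simp add: det_mul)
  also have "\<dots> = det E" by (simp add: UU')
  also have "\<dots> = (\<Prod>i\<in>UNIV. E $ i $ i)" by (rule det_diagonal) (simp add: E_def)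
  also have "\<dots> = (\<Prod>i\<in>UNIV. t - (x $ i)\<^sup>2)" by (simp add: E_def)
  finally show ?thesis by (simp add: X_def)
qed

text \<open>
  Unique factorization: both sides are the same polynomial, so the multisets of roots agree.
\<close>
lemma prod_linear_factors_permutes:
  fixes a b :: "'n::finite \<Rightarrow> real"
  assumes "\<And>t. (\<Prod>i\<in>UNIV. t - a i) = (\<Prod>i\<in>UNIV. t - b i)"
  shows "\<exists>\<pi>. \<pi> permutes UNIV \<and> (\<forall>i. a i = b (\<pi> i))"
proof -
  have poly: "(\<Prod>i\<in>UNIV. [:- a i, 1:]) = (\<Prod>i\<in>UNIV. [:- b i, 1:])"
    using assms by (intro poly_eqI_degree_lead_coeff[where A=UNIV] iffD1[OF poly_eq_poly_eq_iff])
       (auto simp: fun_eq_iff poly_prod algebra_simps)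
  have pr: "proots (\<Prod>i\<in>UNIV. [:- c i, 1:]) = image_mset c (mset_set UNIV)" for c :: "'n \<Rightarrow> real"
    by (subst proots_prod) (simp_all add: sum_unfold_sum_mset)
  have "image_mset a (mset_set UNIV) = image_mset b (mset_set UNIV)"
    using poly pr by metis
  from image_mset_eq_implies_permutes[OF _ this] show ?thesis by auto
qed

text \<open>
  The characteristic polynomial determines the singular values up to order, and \<open>f\<close> sees neither order
  nor signs. Through this lemma the arbitrary choice in the definition of \<open>singular_values\<close> disappears.
\<close>
lemma fun_singular_values:
  fixes f :: "real^'n \<Rightarrow> real" and V :: "real^'p^'n"
  assumes sym: "symmetric_fun f" and sgn: "sign_invariant f"
    and U: "orthonormal_rows U" and V: "orthonormal_rows V"
  shows "f (singular_values (spectral_sum x U V)) = f x"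
proof -
  define X where "X = spectral_sum x U V"
  define s where "s = singular_values X"
  have "is_singular_values X (\<chi> i. \<bar>x $ i\<bar>)"
    unfolding is_singular_values_def X_def by (simp add: det_spectral_sum[OF U V])
  then have s: "is_singular_values X s"
    unfolding s_def singular_values_def by (rule someI)
  then have "(\<Prod>i\<in>UNIV. t - (s $ i)\<^sup>2) = (\<Prod>i\<in>UNIV. t - (x $ i)\<^sup>2)" for t
    using det_spectral_sum[OF U V, of t x] unfolding is_singular_values_def X_def by metis
  then obtain \<pi> where \<pi>: "\<pi> permutes UNIV" "\<And>i. (s $ i)\<^sup>2 = (x $ \<pi> i)\<^sup>2"
    using prod_linear_factors_permutes[of "\<lambda>i. (s $ i)\<^sup>2" "\<lambda>i. (x $ i)\<^sup>2"] by auto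
  have "s $ i = \<bar>x $ \<pi> i\<bar>" for i
  proof -
    have "\<bar>s $ i\<bar> = \<bar>x $ \<pi> i\<bar>" using \<pi>(2)[of i] by (metis real_sqrt_abs)
    then show ?thesis using s by (simp add: is_singular_values_def)
  qed
  then have "s = (\<chi> i. (\<chi> i. \<bar>x $ i\<bar>) $ \<pi> i)" by (simp add: vec_eq_iff)
  then have "f s = f (\<chi> i. \<bar>x $ i\<bar>)" using sym \<pi>(1) unfolding symmetric_fun_def by metis
  also have "\<dots> = f x" using sgn by (simp add: sign_invariant_def)
  finally show ?thesis by (simp add: s_def X_def)
qed

lemma rank_spectral_sum:
  fixes V :: "real^'p^'n"
  assumes U: "orthonormal_rows U" and V: "orthonormal_rows V"
  shows "rank (spectral_sum x U V) = card {i. x $ i \<noteq> 0}"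
proof -
  define B where "B = (\<lambda>i. U $ i) ` {i. x $ i \<noteq> 0}"
  have inj: "inj (\<lambda>i. U $ i)"
    by (metis injI orthonormal_rowsD[OF U] zero_neq_one)
  have "pairwise orthogonal B"
    by (auto simp: pairwise_def B_def orthogonal_def orthonormal_rowsD[OF U])
  moreover have "0 \<notin> B"
    by (auto simp: B_def) (metis inner_zero_left orthonormal_rowsD[OF U] zero_neq_one)
  ultimately have ind: "independent B" by (rule pairwise_orthogonal_independent)
  have "range ((*v) (spectral_sum x U V)) = span B"
  proof
    show "range ((*v) (spectral_sum x U V)) \<subseteq> span B"
    proof clarify
      fix w
      have "(x $ i * (V $ i \<bullet> w)) *\<^sub>R U $ i \<in> span B" for i
        by (cases "x $ i = 0") (auto simp: B_def span_zero intro: span_scale[OF span_base])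
      then show "spectral_sum x U V *v w \<in> span B"
        unfolding spectral_sum_mult by (intro span_sum)
    qed
    have "U $ i \<in> range ((*v) (spectral_sum x U V))" if "x $ i \<noteq> 0" for i
    proof (rule range_eqI)
      show "U $ i = spectral_sum x U V *v ((1 / x $ i) *\<^sub>R V $ i)"
        using that by (simp add: spectral_sum_mult orthonormal_rowsD[OF V]
            if_distrib[of "\<lambda>t. _ * t"] if_distrib[of "\<lambda>t. t *\<^sub>R _"] cong: if_cong)
    qed
    then show "span B \<subseteq> range ((*v) (spectral_sum x U V))"
      by (intro span_minimal) (auto simp: B_def intro!: linear_subspace_image)
  qed
  then have "rank (spectral_sum x U V) = card B"
    by (simp add: rank_dim_range dim_eq_card_independent[OF ind])
  also have "\<dots> = card {i. x $ i \<noteq> 0}"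
    unfolding B_def by (intro card_image) (use inj in \<open>auto simp: inj_on_def\<close>)
  finally show ?thesis .
qed

section \<open>Singular value decomposition\<close>

text \<open>
  The bilinear form attains its maximum on the product of the two unit spheres, which is compact;
  homogeneity gives the stated form.
\<close>
lemma bilinear_max_on_spheres:
  fixes X :: "real^'p^'n"
  assumes "subspace S" "subspace T" "S \<noteq> {0}" "T \<noteq> {0}"
  obtains u v where "u \<in> S" "v \<in> T" "norm u = 1" "norm v = 1"
    "\<And>y z. y \<in> S \<Longrightarrow> z \<in> T \<Longrightarrow> y \<bullet> (X *v z) \<le> (u \<bullet> (X *v v)) * norm y * norm z"
proof -
  define K where "K = (S \<inter> sphere 0 1) \<times> (T \<inter> sphere 0 1)"
  have unit: "W \<inter> sphere 0 1 \<noteq> {}" if W: "subspace W" "W \<noteq> {0}" for W :: "'z::euclidean_space set"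
  proof -
    obtain w where w: "w \<in> W" "w \<noteq> 0" using W subspace_0[OF W(1)] by auto
    then have "(1 / norm w) *\<^sub>R w \<in> W \<inter> sphere 0 1" using W by (simp add: subspace_scale)
    then show ?thesis by blast
  qed
  have "compact K" unfolding K_def
    by (intro compact_Times closed_Int_compact closed_subspace assms compact_sphere)
  moreover have "K \<noteq> {}" using unit[OF assms(1,3)] unit[OF assms(2,4)] by (auto simp: K_def)
  moreover have "continuous_on K (\<lambda>(y, z). y \<bullet> (X *v z))"
    unfolding case_prod_unfold
    by (intro continuous_intros linear_continuous_on_compose[OF _ matrix_vector_mul_linear])
  ultimately obtain q where q: "q \<in> K" "\<And>r. r \<in> K \<Longrightarrow> fst r \<bullet> (X *v snd r) \<le> fst q \<bullet> (X *v snd q)"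
    using continuous_attains_sup[of K "\<lambda>(y, z). y \<bullet> (X *v z)"] by (force simp: case_prod_unfold)
  show ?thesis
  proof (rule that[of "fst q" "snd q"])
    fix y z assume yz: "y \<in> S" "z \<in> T"
    show "y \<bullet> (X *v z) \<le> (fst q \<bullet> (X *v snd q)) * norm y * norm z"
    proof (cases "y = 0 \<or> z = 0")
      case False
      then have "((1 / norm y) *\<^sub>R y, (1 / norm z) *\<^sub>R z) \<in> K"
        using yz assms(1,2) by (auto simp: K_def subspace_scale)
      from q(2)[OF this] have "y \<bullet> (X *v z) / (norm y * norm z) \<le> fst q \<bullet> (X *v snd q)"
        by (simp add: matrix_vector_mult_scaleR field_simps)
      then show ?thesis using False by (simp add: field_simps)
    qed auto
  qed (use q(1) in \<open>auto simp: K_def\<close>)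
qed

text \<open>
  First-order optimality: a linear term dominated by a quadratic one vanishes. The test value
  \<open>t = c / N\<close> with \<open>N > M\<close> would otherwise violate the inequality.
\<close>
lemma zero_if_linear_le_square:
  fixes c M :: real
  assumes "\<And>t. t * c \<le> t\<^sup>2 * M"
  shows "c = 0"
proof (rule ccontr)
  assume "c \<noteq> 0"
  define N where "N = \<bar>M\<bar> + 1"
  have N: "N > 0" "M < N" by (auto simp: N_def)
  have "(c / N) * c \<le> (c / N)\<^sup>2 * M" by (rule assms)
  also have "\<dots> < (c / N)\<^sup>2 * N" using N \<open>c \<noteq> 0\<close> by (intro mult_strict_left_mono) auto
  also have "\<dots> = (c / N) * c" using N by (simp add: power2_eq_square)
  finally show False by simp
qed

lemma le_sqrt_add_square:
  fixes a s N :: real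
  assumes "0 \<le> s" "0 \<le> N" shows "s * sqrt (1 + N) \<le> s + s * N / 2"
proof -
  have "sqrt (1 + N) \<le> 1 + N / 2"
    by (rule real_le_lsqrt) (use assms in \<open>auto simp: power2_eq_square algebra_simps\<close>)
  from mult_left_mono[OF this assms(1)] show ?thesis by (simp add: algebra_simps)
qed

lemma dim_orthogonal_in_subspace:
  fixes S :: "'a::euclidean_space set"
  assumes "subspace S" "u \<in> S" "u \<noteq> 0"
  shows "dim S = Suc (dim {y \<in> S. y \<bullet> u = 0})"
proof -
  have "dim {y \<in> S. \<forall>x\<in>span {u}. orthogonal x y} + dim (span {u}) = dim S"
    by (rule dim_subspace_orthogonal_to_vectors) (use assms in \<open>auto intro: span_minimal[THEN subsetD]\<close>)
  moreover have "{y \<in> S. \<forall>x\<in>span {u}. orthogonal x y} = {y \<in> S. y \<bullet> u = 0}"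
    by (auto simp: span_singleton orthogonal_def inner_commute)
  moreover have "dim (span {u}) = 1"
    using assms(3) by (simp add: dim_eq_card_independent)
  ultimately show ?thesis by simp
qed

lemma orthogonal_decomposition_unit:
  assumes "subspace S" "u \<in> S" "norm u = 1" "y \<in> S"
  obtains y' where "y' \<in> S" "y' \<bullet> u = 0" "y = (y \<bullet> u) *\<^sub>R u + y'"
proof (rule that[of "y - (y \<bullet> u) *\<^sub>R u"])
  show "y - (y \<bullet> u) *\<^sub>R u \<in> S" using assms by (simp add: subspace_diff subspace_scale)
  show "(y - (y \<bullet> u) *\<^sub>R u) \<bullet> u = 0"
    using assms(3) by (simp add: inner_diff_left norm_eq_1)
qed auto

text \<open>
  Greedy construction. A maximizing pair \<open>u0\<close>, \<open>v0\<close> of unit vectors gives the largest singular value;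
  by first-order optimality the form vanishes between \<open>u0\<close> and the complement of \<open>v0\<close>, and vice versa, so
  that the induction continues on the two orthogonal complements. The values come out in decreasing
  order. The index is a number here, since the dimension of the subspaces varies in the induction.
\<close>
lemma svd_on_subspaces:
  fixes X :: "real^'p^'n"
  assumes "subspace S" "subspace T" "dim S = d" "d \<le> dim T"
  shows "\<exists>u v s. (\<forall>i<d. u i \<in> S \<and> v i \<in> T \<and> 0 \<le> s i) \<and>
     (\<forall>i<d. \<forall>j<d. u i \<bullet> u j = (if i = j then 1 else 0) \<and> v i \<bullet> v j = (if i = j then 1 else 0)) \<and>
     (\<forall>i j. i \<le> j \<longrightarrow> j < d \<longrightarrow> s j \<le> s i) \<and>
     (\<forall>y\<in>S. \<forall>z\<in>T. y \<bullet> (X *v z) = (\<Sum>i<d. s i * (y \<bullet> u i) * (z \<bullet> v i)))"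
  using assms
proof (induction d arbitrary: S T)
  case 0
  then have "S \<subseteq> {0}" by (simp add: dim_eq_0)
  then show ?case by fastforce
next
  case (Suc d)
  have "S \<noteq> {0}" "T \<noteq> {0}" using Suc.prems(3,4) by auto
  then obtain u0 v0 where uv0: "u0 \<in> S" "v0 \<in> T" "norm u0 = 1" "norm v0 = 1"
    and max: "\<And>y z. y \<in> S \<Longrightarrow> z \<in> T \<Longrightarrow> y \<bullet> (X *v z) \<le> (u0 \<bullet> (X *v v0)) * norm y * norm z"
    using bilinear_max_on_spheres[OF Suc.prems(1,2)] by metis
  define s0 where "s0 = u0 \<bullet> (X *v v0)"
  have uu: "u0 \<bullet> u0 = 1" "v0 \<bullet> v0 = 1" using uv0 by (simp_all add: norm_eq_1)
  have s0: "0 \<le> s0"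
    using max[of "- u0" v0] uv0 Suc.prems(1) by (simp add: s0_def subspace_neg)
  define S' where "S' = {y \<in> S. y \<bullet> u0 = 0}"
  define T' where "T' = {z \<in> T. z \<bullet> v0 = 0}"
  have "u0 \<noteq> 0" "v0 \<noteq> 0" using uv0 by auto
  have sub: "subspace S'" "subspace T'"
    using Suc.prems(1,2) by (auto simp: S'_def T'_def subspace_def inner_add_left)
  have dims: "dim S = Suc (dim S')" "dim T = Suc (dim T')"
    using dim_orthogonal_in_subspace[OF Suc.prems(1) uv0(1)] dim_orthogonal_in_subspace[OF Suc.prems(2) uv0(2)]
      \<open>u0 \<noteq> 0\<close> \<open>v0 \<noteq> 0\<close> by (auto simp: S'_def T'_def)
  have left: "y \<bullet> (X *v v0) = 0" if y: "y \<in> S'" for y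
  proof (rule zero_if_linear_le_square[of _ "s0 * (y \<bullet> y) / 2"])
    fix t :: real
    have "(u0 + t *\<^sub>R y) \<bullet> (X *v v0) \<le> s0 * norm (u0 + t *\<^sub>R y) * norm v0"
      unfolding s0_def using y Suc.prems(1) uv0
      by (intro max) (auto simp: S'_def subspace_add subspace_scale)
    also have "norm (u0 + t *\<^sub>R y) = sqrt (1 + t\<^sup>2 * (y \<bullet> y))"
      using y by (simp add: norm_eq_sqrt_inner inner_add_left inner_add_right S'_def uu
          inner_commute power2_eq_square algebra_simps)
    also have "s0 * \<dots> * norm v0 \<le> s0 + s0 * (t\<^sup>2 * (y \<bullet> y)) / 2"
      using le_sqrt_add_square[OF s0, of "t\<^sup>2 * (y \<bullet> y)"] uv0 by simp
    finally show "t * (y \<bullet> (X *v v0)) \<le> t\<^sup>2 * (s0 * (y \<bullet> y) / 2)"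
      by (simp add: inner_add_left s0_def[symmetric] algebra_simps)
  qed
  have right: "u0 \<bullet> (X *v z) = 0" if z: "z \<in> T'" for z
  proof (rule zero_if_linear_le_square[of _ "s0 * (z \<bullet> z) / 2"])
    fix t :: real
    have "u0 \<bullet> (X *v (v0 + t *\<^sub>R z)) \<le> s0 * norm u0 * norm (v0 + t *\<^sub>R z)"
      unfolding s0_def using z Suc.prems(2) uv0
      by (intro max) (auto simp: T'_def subspace_add subspace_scale)
    also have "norm (v0 + t *\<^sub>R z) = sqrt (1 + t\<^sup>2 * (z \<bullet> z))"
      using z by (simp add: norm_eq_sqrt_inner inner_add_left inner_add_right T'_def uu
          inner_commute power2_eq_square algebra_simps)
    also have "s0 * norm u0 * \<dots> \<le> s0 + s0 * (t\<^sup>2 * (z \<bullet> z)) / 2"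
      using le_sqrt_add_square[OF s0, of "t\<^sup>2 * (z \<bullet> z)"] uv0 by simp
    finally show "t * (u0 \<bullet> (X *v z)) \<le> t\<^sup>2 * (s0 * (z \<bullet> z) / 2)"
      by (simp add: inner_add_right matrix_vector_right_distrib matrix_vector_mult_scaleR
          s0_def[symmetric] algebra_simps)
  qed
  have "dim S' = d" "d \<le> dim T'" using dims Suc.prems(3,4) by auto
  from Suc.IH[OF sub this] obtain u v s where
    IH: "\<forall>i<d. u i \<in> S' \<and> v i \<in> T' \<and> 0 \<le> s i"
    "\<forall>i<d. \<forall>j<d. u i \<bullet> u j = (if i = j then 1 else 0) \<and> v i \<bullet> v j = (if i = j then 1 else 0)"
    "\<forall>i j. i \<le> j \<longrightarrow> j < d \<longrightarrow> s j \<le> s i"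
    "\<forall>y\<in>S'. \<forall>z\<in>T'. y \<bullet> (X *v z) = (\<Sum>i<d. s i * (y \<bullet> u i) * (z \<bullet> v i))"
    by blast
  have s_le: "s i \<le> s0" if i: "i < d" for i
  proof -
    have "u i \<bullet> (X *v v i) = (\<Sum>q<d. s q * (u i \<bullet> u q) * (v i \<bullet> v q))"
      using IH(1,4) i by blast
    also have "\<dots> = (\<Sum>q<d. if q = i then s i else 0)"
      by (intro sum.cong) (use IH(2) i in auto)
    also have "\<dots> = s i" using i by simp
    finally have "s i = u i \<bullet> (X *v v i)" ..
    also have "\<dots> \<le> s0 * norm (u i) * norm (v i)"
      unfolding s0_def using IH(1) i by (intro max) (auto simp: S'_def T'_def)
    also have "\<dots> = s0" using IH(2) i by (simp add: norm_eq_sqrt_inner)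
    finally show ?thesis .
  qed
  have orth: "u i \<bullet> u0 = 0" "u0 \<bullet> u i = 0" "v i \<bullet> v0 = 0" "v0 \<bullet> v i = 0" if "i < d" for i
    using IH(1) that by (auto simp: S'_def T'_def inner_commute)
  show ?case
  proof (intro exI[of _ "case_nat u0 u"] exI[of _ "case_nat v0 v"] exI[of _ "case_nat s0 s"]
      conjI ballI)
    show "\<forall>i<Suc d. case_nat u0 u i \<in> S \<and> case_nat v0 v i \<in> T \<and> 0 \<le> case_nat s0 s i"
      using IH(1) uv0 s0 by (auto simp: S'_def T'_def split: nat.split)
    show "\<forall>i<Suc d. \<forall>j<Suc d.
       case_nat u0 u i \<bullet> case_nat u0 u j = (if i = j then 1 else 0) \<and>
       case_nat v0 v i \<bullet> case_nat v0 v j = (if i = j then 1 else 0)"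
      using IH(2) orth uu by (auto split: nat.split)
    show "\<forall>i j. i \<le> j \<longrightarrow> j < Suc d \<longrightarrow> case_nat s0 s j \<le> case_nat s0 s i"
      using IH(3) s_le by (auto split: nat.split)
    fix y z assume y: "y \<in> S" and z: "z \<in> T"
    obtain y' where y': "y' \<in> S" "y' \<bullet> u0 = 0" "y = (y \<bullet> u0) *\<^sub>R u0 + y'"
      using orthogonal_decomposition_unit[OF Suc.prems(1) uv0(1,3) y] .
    obtain z' where z': "z' \<in> T" "z' \<bullet> v0 = 0" "z = (z \<bullet> v0) *\<^sub>R v0 + z'"
      using orthogonal_decomposition_unit[OF Suc.prems(2) uv0(2,4) z] .
    have mem: "y' \<in> S'" "z' \<in> T'" using y' z' by (auto simp: S'_def T'_def)
    have "y \<bullet> (X *v z) = ((y \<bullet> u0) *\<^sub>R u0 + y') \<bullet> (X *v ((z \<bullet> v0) *\<^sub>R v0 + z'))"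
      using y'(3) z'(3) by metis
    also have "\<dots> = s0 * (y \<bullet> u0) * (z \<bullet> v0) + y' \<bullet> (X *v z')"
      by (simp add: inner_add_left inner_add_right matrix_vector_right_distrib matrix_vector_mult_scaleR
          left right mem s0_def algebra_simps)
    also have "y' \<bullet> (X *v z') = (\<Sum>i<d. s i * (y' \<bullet> u i) * (z' \<bullet> v i))"
      using mem IH(4) by blast
    also have "\<dots> = (\<Sum>i<d. s i * (y \<bullet> u i) * (z \<bullet> v i))"
    proof (rule sum.cong)
      fix i assume "i \<in> {..<d}"
      then have i: "i < d" by simp
      have "y \<bullet> u i = y' \<bullet> u i" "z \<bullet> v i = z' \<bullet> v i"
        by (subst y'(3), simp add: inner_add_left orth[OF i])
          (subst z'(3), simp add: inner_add_left orth[OF i])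
      then show "s i * (y' \<bullet> u i) * (z' \<bullet> v i) = s i * (y \<bullet> u i) * (z \<bullet> v i)" by simp
    qed simp
    finally show "y \<bullet> (X *v z) =
      (\<Sum>i<Suc d. case_nat s0 s i * (y \<bullet> case_nat u0 u i) * (z \<bullet> case_nat v0 v i))"
      by (subst sum.lessThan_Suc_shift) simp
  qed
qed

text \<open>Nonnegativity is included, since the notion is only used for vectors of singular values.\<close>
definition decreasing :: "real^'n \<Rightarrow> bool" where
  "decreasing x \<longleftrightarrow> (\<forall>i. 0 \<le> x $ i) \<and> (\<forall>i j. pos i \<le> pos j \<longrightarrow> x $ j \<le> x $ i)"

lemma decreasingD:
  "decreasing x \<Longrightarrow> 0 \<le> x $ i"
  "decreasing x \<Longrightarrow> pos i \<le> pos j \<Longrightarrow> x $ j \<le> x $ i"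
  by (auto simp: decreasing_def)

lemma svd:
  fixes X :: "real^'p^'n"
  assumes "CARD('n) \<le> CARD('p)"
  obtains s U V where "decreasing s" "orthonormal_rows U" "orthonormal_rows V"
    "X = spectral_sum s U V"
proof -
  let ?d = "CARD('n)"
  have "dim (UNIV :: (real^'n) set) = ?d" "?d \<le> dim (UNIV :: (real^'p) set)"
    using assms by (simp_all add: dim_UNIV)
  from svd_on_subspaces[OF subspace_UNIV subspace_UNIV this, of X]
  obtain u :: "nat \<Rightarrow> real^'n" and v :: "nat \<Rightarrow> real^'p" and s where
    s0: "\<forall>i<?d. u i \<in> UNIV \<and> v i \<in> UNIV \<and> 0 \<le> s i" and
    orth: "\<forall>i<?d. \<forall>j<?d. u i \<bullet> u j = (if i = j then 1 else 0) \<and> v i \<bullet> v j = (if i = j then 1 else 0)" and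
    dec: "\<forall>i j. i \<le> j \<longrightarrow> j < ?d \<longrightarrow> s j \<le> s i" and
    X: "\<forall>y\<in>UNIV. \<forall>z\<in>UNIV. y \<bullet> (X *v z) = (\<Sum>i<?d. s i * (y \<bullet> u i) * (z \<bullet> v i))"
    by blast
  define U where "U = (\<chi> i. u (pos i) :: real^'n^'n)"
  define V where "V = (\<chi> i. v (pos i) :: real^'p^'n)"
  define x where "x = (\<chi> i. s (pos i) :: real^'n)"
  have "y \<bullet> (X *v z) = y \<bullet> (spectral_sum x U V *v z)" for y z
  proof -
    have "y \<bullet> (spectral_sum x U V *v z) = (\<Sum>i\<in>(UNIV :: 'n set). s (pos i) * (y \<bullet> u (pos i)) * (z \<bullet> v (pos i)))"
      by (simp add: spectral_sum_mult inner_sum_right x_def U_def V_def inner_commute mult_ac)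
    also have "\<dots> = (\<Sum>i<?d. s i * (y \<bullet> u i) * (z \<bullet> v i))"
      by (rule sum.reindex_bij_betw[OF bij_pos])
    finally show ?thesis using X by simp
  qed
  then have "X *v z = spectral_sum x U V *v z" for z
    using vector_eq_ldot by blast
  then have "X = spectral_sum x U V" by (simp add: matrix_eq)
  moreover have "decreasing x" using s0 dec pos_less[where 'a='n] unfolding decreasing_def x_def by simp
  moreover have "orthonormal_rows U" "orthonormal_rows V"
    using orth pos_less[where 'a='n] by (simp_all add: orthonormal_rows_def U_def V_def)
  ultimately show ?thesis using that by blast
qed

section \<open>The Ky Fan inequalities\<close>

text \<open>
  A bathtub argument: with total mass at most \<open>card J\<close> and at most one unit per place, the weighted sum
  is largest when all mass sits on \<open>J\<close>, where the values exceed the threshold \<open>\<tau>\<close>.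
\<close>
lemma weighted_sum_le:
  fixes w \<kappa> :: "'i \<Rightarrow> real"
  assumes "finite I" "J \<subseteq> I" and w: "\<And>i. i \<in> I \<Longrightarrow> 0 \<le> w i" "\<And>i. i \<in> I \<Longrightarrow> w i \<le> 1"
    and sum: "sum w I \<le> card J" and "0 \<le> \<tau>"
    and J: "\<And>i. i \<in> J \<Longrightarrow> \<tau> \<le> \<kappa> i" and IJ: "\<And>i. i \<in> I - J \<Longrightarrow> \<kappa> i \<le> \<tau>"
  shows "(\<Sum>i\<in>I. \<kappa> i * w i) \<le> sum \<kappa> J"
proof -
  have fJ: "finite J" using assms(1,2) finite_subset by blast
  have split: "sum g I = sum g J + sum g (I - J)" for g :: "'i \<Rightarrow> real"
    using sum.subset_diff[OF assms(2,1), of g] by simp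
  have "(\<Sum>i\<in>I - J. \<kappa> i * w i) \<le> (\<Sum>i\<in>I - J. \<tau> * w i)"
    by (intro sum_mono mult_right_mono) (use IJ w in auto)
  also have "\<dots> = \<tau> * (sum w I - sum w J)" by (simp add: split sum_distrib_left)
  also have "\<dots> \<le> \<tau> * (\<Sum>i\<in>J. 1 - w i)"
    using sum \<open>0 \<le> \<tau>\<close> by (intro mult_left_mono) (simp_all add: sum_subtractf)
  also have "\<dots> = (\<Sum>i\<in>J. \<tau> * (1 - w i))" by (rule sum_distrib_left)
  also have "\<dots> \<le> (\<Sum>i\<in>J. \<kappa> i * (1 - w i))"
    by (intro sum_mono mult_right_mono) (use J w assms(2) in auto)
  also have "\<dots> = sum \<kappa> J - (\<Sum>i\<in>J. \<kappa> i * w i)"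
    by (simp add: sum_subtractf right_diff_distrib)
  finally show ?thesis by (simp add: split)
qed

text \<open>
  The Ky Fan norm of order \<open>l\<close> of \<open>Z\<close> is the maximum of \<open>partial_isometry l P Q \<bullet> Z\<close> over all \<open>P\<close> and
  \<open>Q\<close> with orthonormal rows. Working with these linear functionals makes it unnecessary to know the
  singular values of sums and perturbations.
\<close>
definition partial_isometry :: "nat \<Rightarrow> real^'n^'n \<Rightarrow> real^'p^'n \<Rightarrow> real^'p^'n" where
  "partial_isometry l P Q = (\<Sum>i | pos i < l. outer (P $ i) (Q $ i))"

definition leading_sum :: "nat \<Rightarrow> real^'n \<Rightarrow> real" where
  "leading_sum l x = (\<Sum>i | pos i < l. x $ i)"

lemma inner_partial_isometry: "partial_isometry l P Q \<bullet> Z = (\<Sum>i | pos i < l. P $ i \<bullet> (Z *v Q $ i))"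
  by (simp add: partial_isometry_def inner_sum_left inner_outer)

lemma mult_le_mean_squares: "a * b \<le> (a\<^sup>2 + b\<^sup>2) / (2::real)"
  using sum_squares_bound[of a b] by simp

lemma partial_isometry_inner_outer_le:
  assumes P: "orthonormal_rows P" and Q: "orthonormal_rows Q"
  shows "partial_isometry l P Q \<bullet> outer y z \<le> (y \<bullet> y + z \<bullet> z) / 2"
proof -
  have "partial_isometry l P Q \<bullet> outer y z = (\<Sum>i | pos i < l. (P $ i \<bullet> y) * (Q $ i \<bullet> z))"
    by (simp add: partial_isometry_def inner_sum_left inner_outer_outer)
  also have "\<dots> \<le> (\<Sum>i | pos i < l. ((P $ i \<bullet> y)\<^sup>2 + (Q $ i \<bullet> z)\<^sup>2) / 2)"
    by (intro sum_mono mult_le_mean_squares)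
  also have "\<dots> = ((\<Sum>i | pos i < l. (P $ i \<bullet> y)\<^sup>2) + (\<Sum>i | pos i < l. (Q $ i \<bullet> z)\<^sup>2)) / 2"
    by (simp add: sum_divide_distrib[symmetric] sum.distrib)
  also have "\<dots> \<le> (y \<bullet> y + z \<bullet> z) / 2"
    using bessel[OF P, of y "{i. pos i < l}"] bessel[OF Q, of z "{i. pos i < l}"] by simp
  finally show ?thesis .
qed

text \<open>
  The pairing of \<open>Z\<close> with a partial isometry is a sum of values of the bilinear form. Exchanging the
  order of summation turns the bound on the form into a weighted sum of the \<open>\<kappa> $ i\<close>, and by Bessel's
  inequality, applied to \<open>P\<close>, \<open>Q\<close> and to \<open>U\<close>, \<open>V\<close>, the weights satisfy the hypotheses of
  \<open>weighted_sum_le\<close>. Note that \<open>\<kappa>\<close> need not be decreasing: only the threshold at position \<open>l\<close> matters,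
  which leaves room for perturbations.
\<close>
lemma ky_fan_weighted:
  fixes Z V Q :: "real^'p^'n" and U P :: "real^'n^'n" and \<kappa> :: "real^'n"
  assumes U: "orthonormal_rows U" and V: "orthonormal_rows V"
    and P: "orthonormal_rows P" and Q: "orthonormal_rows Q"
    and "0 \<le> \<tau>" "\<And>i. pos i < l \<Longrightarrow> \<tau> \<le> \<kappa> $ i" "\<And>i. l \<le> pos i \<Longrightarrow> \<kappa> $ i \<le> \<tau>"
    and Z: "\<And>y z. y \<bullet> (Z *v z) \<le> (\<Sum>i\<in>UNIV. \<kappa> $ i * (((U $ i \<bullet> y)\<^sup>2 + (V $ i \<bullet> z)\<^sup>2) / 2))"
  shows "partial_isometry l P Q \<bullet> Z \<le> leading_sum l \<kappa>"
proof -
  define J where "J = {i::'n. pos i < l}"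
  define w where "w i = (\<Sum>m\<in>J. ((P $ m \<bullet> U $ i)\<^sup>2 + (Q $ m \<bullet> V $ i)\<^sup>2) / 2)" for i
  have w1: "w i \<le> 1" for i
  proof -
    have "w i = ((\<Sum>m\<in>J. (P $ m \<bullet> U $ i)\<^sup>2) + (\<Sum>m\<in>J. (Q $ m \<bullet> V $ i)\<^sup>2)) / 2"
      by (simp add: w_def sum_divide_distrib[symmetric] sum.distrib)
    also have "\<dots> \<le> (U $ i \<bullet> U $ i + V $ i \<bullet> V $ i) / 2"
      using bessel[OF P, of "U $ i" J] bessel[OF Q, of "V $ i" J] by simp
    also have "\<dots> = 1" by (simp add: orthonormal_rowsD[OF U] orthonormal_rowsD[OF V])
    finally show ?thesis .
  qed
  have "sum w UNIV = (\<Sum>m\<in>J. \<Sum>i\<in>UNIV. ((U $ i \<bullet> P $ m)\<^sup>2 + (V $ i \<bullet> Q $ m)\<^sup>2) / 2)"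
    unfolding w_def by (subst sum.swap) (simp add: inner_commute)
  also have "\<dots> = (\<Sum>m\<in>J. ((\<Sum>i\<in>UNIV. (U $ i \<bullet> P $ m)\<^sup>2) + (\<Sum>i\<in>UNIV. (V $ i \<bullet> Q $ m)\<^sup>2)) / 2)"
    by (simp add: sum_divide_distrib[symmetric] sum.distrib)
  also have "\<dots> \<le> (\<Sum>m\<in>J. 1)"
  proof (rule sum_mono)
    fix m
    show "((\<Sum>i\<in>UNIV. (U $ i \<bullet> P $ m)\<^sup>2) + (\<Sum>i\<in>UNIV. (V $ i \<bullet> Q $ m)\<^sup>2)) / 2 \<le> 1"
      using bessel[OF U, of "P $ m" UNIV] bessel[OF V, of "Q $ m" UNIV]
      by (simp add: orthonormal_rowsD[OF P] orthonormal_rowsD[OF Q])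
  qed
  finally have wsum: "sum w UNIV \<le> card J" by simp
  have "partial_isometry l P Q \<bullet> Z = (\<Sum>m\<in>J. P $ m \<bullet> (Z *v Q $ m))"
    by (simp add: inner_partial_isometry J_def)
  also have "\<dots> \<le> (\<Sum>m\<in>J. \<Sum>i\<in>UNIV. \<kappa> $ i * (((U $ i \<bullet> P $ m)\<^sup>2 + (V $ i \<bullet> Q $ m)\<^sup>2) / 2))"
    by (intro sum_mono Z)
  also have "\<dots> = (\<Sum>i\<in>UNIV. \<kappa> $ i * w i)"
    unfolding w_def by (subst sum.swap) (simp add: sum_distrib_left inner_commute)
  also have "\<dots> \<le> (\<Sum>i\<in>J. \<kappa> $ i)"
    by (rule weighted_sum_le[where \<tau>=\<tau>]) (use assms wsum w1 in \<open>auto simp: J_def w_def intro!: sum_nonneg\<close>)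
  finally show ?thesis by (simp add: leading_sum_def J_def)
qed

lemma spectral_sum_form_le:
  assumes "\<And>i. 0 \<le> s $ i"
  shows "y \<bullet> (spectral_sum s U V *v z) \<le> (\<Sum>i\<in>UNIV. s $ i * (((U $ i \<bullet> y)\<^sup>2 + (V $ i \<bullet> z)\<^sup>2) / 2))"
proof -
  have "y \<bullet> (spectral_sum s U V *v z) = (\<Sum>i\<in>UNIV. s $ i * ((U $ i \<bullet> y) * (V $ i \<bullet> z)))"
    by (simp add: spectral_sum_mult inner_sum_right inner_commute mult_ac)
  also have "\<dots> \<le> (\<Sum>i\<in>UNIV. s $ i * (((U $ i \<bullet> y)\<^sup>2 + (V $ i \<bullet> z)\<^sup>2) / 2))"
    by (intro sum_mono mult_left_mono mult_le_mean_squares assms)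
  finally show ?thesis .
qed

text \<open>
  Each term \<open>s\<^sub>i (u\<^sub>i \<bullet> y) (v\<^sub>i \<bullet> z)\<close> is bounded by means of squares; the threshold is the entry of \<open>s\<close>
  at position \<open>l\<close>, or \<open>0\<close> if there is none.
\<close>
lemma ky_fan:
  fixes V :: "real^'p^'n"
  assumes s: "decreasing s" and U: "orthonormal_rows U" and V: "orthonormal_rows V"
    and P: "orthonormal_rows P" and Q: "orthonormal_rows Q"
  shows "partial_isometry l P Q \<bullet> spectral_sum s U V \<le> leading_sum l s"
proof -
  obtain \<tau> where "0 \<le> \<tau>" "\<And>i. pos i < l \<Longrightarrow> \<tau> \<le> s $ i" "\<And>i. l \<le> pos i \<Longrightarrow> s $ i \<le> \<tau>"
  proof (cases "l < CARD('n)")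
    case True
    then obtain q :: 'n where "pos q = l" using pos_surj by blast
    then show ?thesis using that[of "s $ q"] decreasingD[OF s] by (metis less_imp_le)
  next
    case False
    then have "pos i < l" for i :: 'n by (metis not_less order_less_le_trans pos_less)
    then show ?thesis using that[of 0] decreasingD[OF s] by (metis not_less order_refl)
  qed
  from ky_fan_weighted[OF U V P Q this] show ?thesis
    using spectral_sum_form_le decreasingD(1)[OF s] by blast
qed

lemma inner_outer_spectral_sum:
  assumes "orthonormal_rows U" "orthonormal_rows V"
  shows "outer (U $ i) (V $ i) \<bullet> spectral_sum s U V = s $ i"
  using orthonormal_rowsD[OF assms(1), of i] orthonormal_rowsD[OF assms(2), of i]
  by (simp add: spectral_sum_def inner_sum_right inner_outer_outer
      if_distrib[of "\<lambda>t. _ * t"] cong: if_cong)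

lemma ky_fan_attained:
  assumes "orthonormal_rows U" "orthonormal_rows V"
  shows "partial_isometry l U V \<bullet> spectral_sum s U V = leading_sum l s"
  by (simp add: partial_isometry_def leading_sum_def inner_sum_left inner_outer_spectral_sum[OF assms])

section \<open>The convex hull of the domain set\<close>

text \<open>
  Summation by parts. The induction proves more, namely a bound by \<open>\<tau>\<close> times the partial sum for each
  lower bound \<open>\<tau>\<close> of the leading entries of \<open>c\<close>; the hypothesis on the partial sums then allows
  \<open>\<tau>\<close> to be lowered to the next entry.
\<close>
lemma sum_decreasing_mult_nonpos:
  fixes c d :: "real^'n"
  assumes c: "decreasing c" and d: "\<And>l. leading_sum l d \<le> 0"
  shows "(\<Sum>i\<in>UNIV. c $ i * d $ i) \<le> 0"
proof -
  have *: "(\<Sum>i | pos i < l. c $ i * d $ i) \<le> \<tau> * leading_sum l d"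
    if "l \<le> CARD('n)" "0 \<le> \<tau>" "\<And>i. pos i < l \<Longrightarrow> \<tau> \<le> c $ i" for l \<tau>
    using that
  proof (induction l arbitrary: \<tau>)
    case 0 then show ?case by (simp add: leading_sum_def)
  next
    case (Suc l)
    then obtain q :: 'n where q: "pos q = l" using pos_surj[of l, where 'a='n] by auto
    have IH: "(\<Sum>i | pos i < l. c $ i * d $ i) \<le> c $ q * leading_sum l d"
      using Suc.prems(1) decreasingD[OF c] q by (intro Suc.IH) auto
    have "(\<Sum>i | pos i < Suc l. c $ i * d $ i) = c $ q * d $ q + (\<Sum>i | pos i < l. c $ i * d $ i)"
      by (simp add: pos_less_Suc[OF q] q)
    also have "\<dots> \<le> c $ q * d $ q + c $ q * leading_sum l d"
      using IH by simp
    also have "\<dots> = c $ q * leading_sum (Suc l) d"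
      by (simp add: leading_sum_def pos_less_Suc[OF q] q algebra_simps)
    also have "\<dots> \<le> \<tau> * leading_sum (Suc l) d"
      using Suc.prems(3)[of q] q d[of "Suc l"] by (simp add: mult_right_mono_neg)
    finally show ?case .
  qed
  have "(\<Sum>i | pos i < CARD('n). c $ i * d $ i) \<le> 0 * leading_sum CARD('n) d"
    using decreasingD(1)[OF c] by (intro *) auto
  then show ?thesis using pos_less_all[of "CARD('n)", where 'a='n] by simp
qed

lemma compact_orthonormal_rows: "compact {P :: real^'m^'n. orthonormal_rows P}"
proof -
  have "norm P \<le> sqrt CARD('n)" if "orthonormal_rows P" for P :: "real^'m^'n"
    using orthonormal_rowsD[OF that] by (simp add: norm_eq_sqrt_inner inner_vec_def[of P])
  then have "bounded {P :: real^'m^'n. orthonormal_rows P}" by (auto intro: boundedI)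
  moreover have "closed {P :: real^'m^'n. orthonormal_rows P}"
    unfolding orthonormal_rows_def
    by (intro closed_Collect_all closed_Collect_eq continuous_intros)
  ultimately show ?thesis by (simp add: compact_eq_bounded_closed)
qed

lemma continuous_on_spectral_sum:
  "continuous_on A (\<lambda>q. spectral_sum (fst q) (fst (snd q)) (snd (snd q)))"
  unfolding spectral_sum_def outer_def by (intro continuous_intros)

text \<open>
  For decreasing \<open>x\<close> this says that the vector of singular values of \<open>Z\<close> is weakly majorized by \<open>x\<close>.
\<close>
definition dominated :: "real^'n \<Rightarrow> real^'p^'n \<Rightarrow> bool" where
  "dominated x Z \<longleftrightarrow> (\<forall>l P Q. orthonormal_rows P \<longrightarrow> orthonormal_rows Q \<longrightarrow>
     partial_isometry l P Q \<bullet> Z \<le> leading_sum l x)"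

text \<open>
  The hull is compact, so a matrix outside it is separated from it by some functional \<open>- a\<close>. Writing
  \<open>- a\<close> in singular form with systems \<open>P\<close>, \<open>Q\<close>, the point \<open>spectral_sum x P Q\<close> of the hull does at least
  as well as \<open>Z\<close>: this is the domination for these \<open>P\<close>, \<open>Q\<close>, summed by parts.
\<close>
lemma dominated_in_hull:
  fixes Z :: "real^'p^'n"
  assumes np: "CARD('n) \<le> CARD('p)" and dom: "dominated x Z"
  shows "Z \<in> convex hull {spectral_sum x P Q | P Q. orthonormal_rows P \<and> orthonormal_rows Q}"
    (is "_ \<in> convex hull ?S")
proof (rule ccontr)
  assume Z: "Z \<notin> convex hull ?S"
  define K where "K = {x} \<times> {P :: real^'n^'n. orthonormal_rows P} \<times> {Q :: real^'p^'n. orthonormal_rows Q}"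
  have S: "?S = (\<lambda>q. spectral_sum (fst q) (fst (snd q)) (snd (snd q))) ` K"
    by (force simp: K_def)
  have "compact ?S" unfolding S K_def
    by (intro compact_continuous_image continuous_on_spectral_sum compact_Times compact_orthonormal_rows) simp
  then have "closed (convex hull ?S)" by (intro compact_imp_closed compact_convex_hull)
  then obtain a b where ab: "a \<bullet> Z < b" "\<And>y. y \<in> convex hull ?S \<Longrightarrow> b < a \<bullet> y"
    using separating_hyperplane_closed_point[OF convex_convex_hull _ Z] by auto
  obtain c P Q where c: "decreasing c" and PQ: "orthonormal_rows P" "orthonormal_rows Q"
    and a: "- a = spectral_sum c P Q"
    using svd[OF np] by metis
  define d where "d = (\<chi> i. outer (P $ i) (Q $ i) \<bullet> Z - x $ i)"
  have "- a \<bullet> Z = (\<Sum>i\<in>UNIV. c $ i * (outer (P $ i) (Q $ i) \<bullet> Z))"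
    unfolding a by (simp add: spectral_sum_def inner_sum_left)
  moreover have "- a \<bullet> spectral_sum x P Q = (\<Sum>i\<in>UNIV. c $ i * x $ i)"
    unfolding a by (simp add: spectral_sum_def[of c] inner_sum_left inner_outer_spectral_sum[OF PQ])
  ultimately have "- a \<bullet> Z - (- a \<bullet> spectral_sum x P Q) = (\<Sum>i\<in>UNIV. c $ i * d $ i)"
    by (simp add: d_def right_diff_distrib sum_subtractf)
  also have "\<dots> \<le> 0"
  proof (rule sum_decreasing_mult_nonpos[OF c])
    fix l
    have "leading_sum l d = partial_isometry l P Q \<bullet> Z - leading_sum l x"
      by (simp add: leading_sum_def d_def sum_subtractf partial_isometry_def inner_sum_left)
    then show "leading_sum l d \<le> 0" using dom PQ by (simp add: dominated_def)
  qed
  finally have "a \<bullet> spectral_sum x P Q \<le> a \<bullet> Z" by simp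
  moreover have "spectral_sum x P Q \<in> convex hull ?S" using PQ by (intro hull_inc) blast
  ultimately show False using ab by fastforce
qed

lemma card_pos_less_le: "card {i::'a::finite. pos i < l} \<le> l"
proof (cases "l \<le> CARD('a)")
  case False
  then have "card {i::'a::finite. pos i < l} \<le> CARD('a)" by (intro card_mono) auto
  then show ?thesis using False by simp
qed (simp add: card_pos_less)

text \<open>The nonzero entries form an initial segment, whose length is their number.\<close>
lemma decreasing_support:
  assumes s: "decreasing s"
  shows "s $ i \<noteq> 0 \<longleftrightarrow> pos i < card {i. s $ i \<noteq> 0}"
proof
  assume i: "s $ i \<noteq> 0"
  have "{q. pos q < Suc (pos i)} \<subseteq> {i. s $ i \<noteq> 0}"
  proof clarify
    fix q assume "pos q < Suc (pos i)" "s $ q = 0"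
    then have "s $ i \<le> 0" using decreasingD(2)[OF s, of q i] by simp
    then show False using i decreasingD(1)[OF s, of i] by simp
  qed
  then have "card {q::'a. pos q < Suc (pos i)} \<le> card {i. s $ i \<noteq> 0}" by (intro card_mono) auto
  then show "pos i < card {i. s $ i \<noteq> 0}"
    using card_pos_less[of "Suc (pos i)", where 'a='a] pos_less[of i] by simp
next
  assume *: "pos i < card {i. s $ i \<noteq> 0}"
  show "s $ i \<noteq> 0"
  proof
    assume "s $ i = 0"
    then have "s $ q = 0" if "pos i \<le> pos q" for q
      using decreasingD(1)[OF s, of q] decreasingD(2)[OF s that] by simp
    then have "{i. s $ i \<noteq> 0} \<subseteq> {q. pos q < pos i}" by (auto simp: not_le[symmetric])
    then have "card {i. s $ i \<noteq> 0} \<le> card {q::'a. pos q < pos i}" by (intro card_mono) auto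
    then show False using * card_pos_less_le[of "pos i", where 'a='a] by linarith
  qed
qed

definition supported_within :: "nat \<Rightarrow> real^'n \<Rightarrow> bool" where
  "supported_within k x \<longleftrightarrow> (\<forall>i. k \<le> pos i \<longrightarrow> x $ i = 0)"

lemma spectral_sum_in_domain_set:
  fixes V :: "real^'p^'n"
  assumes "symmetric_fun f" "sign_invariant f" "orthonormal_rows U" "orthonormal_rows V"
    "supported_within k x" "f x \<le> 0"
  shows "spectral_sum x U V \<in> domain_set f k"
proof -
  have "card {i. x $ i \<noteq> 0} \<le> card {i::'n. pos i < k}"
    using assms(5) by (intro card_mono) (auto simp: supported_within_def not_le[symmetric])
  then have "rank (spectral_sum x U V) \<le> k"
    using card_pos_less_le[of k, where 'a='n] by (simp add: rank_spectral_sum assms)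
  then show ?thesis
    using assms(6) fun_singular_values[OF assms(1-4)] by (simp add: domain_set_def)
qed

lemma domain_set_svd:
  fixes X :: "real^'p^'n"
  assumes "CARD('n) \<le> CARD('p)" "symmetric_fun f" "sign_invariant f" "X \<in> domain_set f k"
  obtains s U V where "decreasing s" "orthonormal_rows U" "orthonormal_rows V"
    "X = spectral_sum s U V" "supported_within k s" "f s \<le> 0"
proof -
  obtain s U V where s: "decreasing s" "orthonormal_rows U" "orthonormal_rows V"
    "X = spectral_sum s U V"
    using svd[OF assms(1)] .
  have "card {i. s $ i \<noteq> 0} \<le> k"
    using assms(4) s by (simp add: domain_set_def rank_spectral_sum)
  then have "supported_within k s"
    unfolding supported_within_def using decreasing_support[OF s(1)] by (metis not_le order_trans)
  moreover have "f s \<le> 0"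
    using assms(4) fun_singular_values[OF assms(2,3) s(2,3)] s(4) by (simp add: domain_set_def)
  ultimately show ?thesis using that s by blast
qed

lemma leading_sum_linear: "leading_sum l (a *\<^sub>R x + b *\<^sub>R y) = a * leading_sum l x + b * leading_sum l y"
  by (simp add: leading_sum_def sum.distrib sum_distrib_left)

text \<open>
  The set on the right is convex, since \<open>f\<close> is convex and decreasing vectors, partial sums and pairings
  behave linearly under averaging; it contains the domain set by the Ky Fan inequalities. Conversely,
  for a given \<open>x\<close> every \<open>spectral_sum x P Q\<close> lies in the domain set, so \<open>dominated_in_hull\<close> applies.
\<close>
theorem convex_hull_domain_set:
  fixes f :: "real^'n \<Rightarrow> real"
  assumes np: "CARD('n) \<le> CARD('p)" and cvx: "convex_on UNIV f"
    and sym: "symmetric_fun f" and sgn: "sign_invariant f"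
  shows "convex hull (domain_set f k :: (real^'p^'n) set) =
    {Z. \<exists>x. decreasing x \<and> supported_within k x \<and> f x \<le> 0 \<and> dominated x Z}" (is "_ = ?G")
proof
  have "convex ?G"
  proof (rule convexI)
    fix Y Z and a b :: real
    assume Y: "Y \<in> ?G" and Z: "Z \<in> ?G" and ab: "0 \<le> a" "0 \<le> b" "a + b = 1"
    obtain y where y: "decreasing y" "supported_within k y" "f y \<le> 0" "dominated y Y" using Y by blast
    obtain z where z: "decreasing z" "supported_within k z" "f z \<le> 0" "dominated z Z" using Z by blast
    let ?x = "a *\<^sub>R y + b *\<^sub>R z"
    have "f ?x \<le> a * f y + b * f z" using cvx ab unfolding convex_on_def by blast
    also have "\<dots> \<le> 0" using ab y z by (simp add: add_nonpos_nonpos mult_nonneg_nonpos)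
    finally have "f ?x \<le> 0" .
    moreover have "decreasing ?x"
      using y(1) z(1) ab unfolding decreasing_def by (auto intro!: add_mono mult_left_mono)
    moreover have "supported_within k ?x" using y(2) z(2) by (simp add: supported_within_def)
    moreover have "dominated ?x (a *\<^sub>R Y + b *\<^sub>R Z)"
      unfolding dominated_def leading_sum_linear inner_add_right inner_scaleR_right
      using y(4) z(4) ab by (auto simp: dominated_def intro!: add_mono mult_left_mono)
    ultimately show "a *\<^sub>R Y + b *\<^sub>R Z \<in> ?G" by blast
  qed
  moreover have "domain_set f k \<subseteq> ?G"
  proof
    fix X :: "real^'p^'n" assume "X \<in> domain_set f k"
    then obtain s U V where "decreasing s" "orthonormal_rows U" "orthonormal_rows V"
      "X = spectral_sum s U V" "supported_within k s" "f s \<le> 0"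
      using domain_set_svd[OF np sym sgn] by blast
    moreover from this have "dominated s X" by (simp add: dominated_def ky_fan)
    ultimately show "X \<in> ?G" by blast
  qed
  ultimately show "convex hull (domain_set f k) \<subseteq> ?G" by (simp add: hull_minimal)
next
  show "?G \<subseteq> convex hull (domain_set f k)"
  proof clarify
    fix Z :: "real^'p^'n" and x
    assume x: "supported_within k x" "f x \<le> 0" "dominated x Z"
    have "{spectral_sum x P Q | P Q. orthonormal_rows P \<and> orthonormal_rows Q}
      \<subseteq> (domain_set f k :: (real^'p^'n) set)"
      using spectral_sum_in_domain_set[OF sym sgn] x by blast
    then show "Z \<in> convex hull (domain_set f k)"
      using dominated_in_hull[OF np x(3)] hull_mono by blast
  qed
qed

section \<open>Perturbing a block of singular values\<close>

lemma leading_sum_0 [simp]: "leading_sum 0 x = 0"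
  by (simp add: leading_sum_def)

lemma leading_sum_Suc: "pos i = l \<Longrightarrow> leading_sum (Suc l) x = leading_sum l x + x $ i"
  by (simp add: leading_sum_def pos_less_Suc)

lemma leading_sum_mono:
  assumes "\<And>i. 0 \<le> x $ i" "l \<le> l'"
  shows "leading_sum l x \<le> leading_sum l' x"
  unfolding leading_sum_def by (rule sum_mono2) (use assms in auto)

lemma leading_sum_supported:
  assumes "supported_within k x" "k \<le> l"
  shows "leading_sum l x = (\<Sum>i\<in>UNIV. x $ i)"
  unfolding leading_sum_def
  by (rule sum.mono_neutral_left) (use assms in \<open>auto simp: supported_within_def\<close>)

lemma partial_isometry_inner_outer_orthonormal_le:
  assumes "orthonormal_rows P" "orthonormal_rows Q" "orthonormal_rows U" "orthonormal_rows V"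
  shows "partial_isometry l P Q \<bullet> outer (U $ i) (V $ i) \<le> 1"
    "- 1 \<le> partial_isometry l P Q \<bullet> outer (U $ i) (V $ i)"
proof -
  have u: "U $ i \<bullet> U $ i = 1" "V $ i \<bullet> V $ i = 1"
    by (simp_all add: orthonormal_rowsD[OF assms(3)] orthonormal_rowsD[OF assms(4)])
  show "partial_isometry l P Q \<bullet> outer (U $ i) (V $ i) \<le> 1"
    using partial_isometry_inner_outer_le[OF assms(1,2), of l "U $ i" "V $ i"] u by simp
  have "outer (- U $ i) (V $ i) = - outer (U $ i) (V $ i)"
    using outer_scaleR_left[of "-1" "U $ i" "V $ i"] by simp
  then show "- 1 \<le> partial_isometry l P Q \<bullet> outer (U $ i) (V $ i)"
    using partial_isometry_inner_outer_le[OF assms(1,2), of l "- U $ i" "V $ i"] u by simp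
qed

text \<open>
  The perturbation \<open>D\<close> acts on the singular directions \<open>a\<close> and \<open>b\<close>, beyond position \<open>j\<close>. There are three
  ranges of orders. Up to \<open>j\<close>, the assumption \<open>form\<close> bounds \<open>D\<close> by an increase of the entries \<open>a\<close> and \<open>b\<close>
  by \<open>\<epsilon>\<close>, which by \<open>gap\<close> does not lift them above the leading \<open>j\<close> entries. Between \<open>j\<close> and \<open>r\<close>
  the slack absorbs \<open>D\<close>. From \<open>r\<close> on, the total of the singular values must not be exceeded; this is
  what \<open>trace\<close> provides: a partial isometry gains on \<open>D\<close> at most \<open>\<epsilon>\<close> times the amount by which its
  pairings with the outer products \<open>a\<close> and \<open>b\<close> fall short of \<open>1\<close>, and these have coefficients
  at least \<open>\<epsilon>\<close> in the singular form.
\<close>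
lemma dominated_perturbation:
  fixes V :: "real^'p^'n" and D :: "real^'p^'n"
  assumes s: "decreasing s" and U: "orthonormal_rows U" and V: "orthonormal_rows V"
    and \<epsilon>: "0 \<le> \<epsilon>" "\<epsilon> \<le> s $ a" "\<epsilon> \<le> s $ b"
    and ab: "a \<noteq> b" "j \<le> pos a" "j \<le> pos b"
    and gap: "\<And>i i'. pos i < j \<Longrightarrow> j \<le> pos i' \<Longrightarrow> s $ i' + \<epsilon> \<le> s $ i"
    and low: "\<And>l. l \<le> j \<Longrightarrow> leading_sum l s \<le> leading_sum l x"
    and slack: "\<And>l. j < l \<Longrightarrow> l < r \<Longrightarrow> leading_sum l s + 4 * \<epsilon> \<le> leading_sum l x"
    and total: "\<And>l. r \<le> l \<Longrightarrow> (\<Sum>i\<in>UNIV. s $ i) \<le> leading_sum l x"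
    and form: "\<And>y z. y \<bullet> (D *v z) \<le> \<epsilon> * (((U $ a \<bullet> y)\<^sup>2 + (V $ a \<bullet> z)\<^sup>2) / 2) +
                            \<epsilon> * (((U $ b \<bullet> y)\<^sup>2 + (V $ b \<bullet> z)\<^sup>2) / 2)"
    and trace: "\<And>l P Q. orthonormal_rows P \<Longrightarrow> orthonormal_rows Q \<Longrightarrow>
      partial_isometry l P Q \<bullet> D \<le>
        \<epsilon> * ((1 - partial_isometry l P Q \<bullet> outer (U $ a) (V $ a)) +
             (1 - partial_isometry l P Q \<bullet> outer (U $ b) (V $ b)))"
  shows "dominated x (spectral_sum s U V + D)"
  unfolding dominated_def
proof (intro allI impI)
  fix l and P :: "real^'n^'n" and Q :: "real^'p^'n"
  assume PQ: "orthonormal_rows P" "orthonormal_rows Q"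
  define X where "X = spectral_sum s U V"
  define t where "t i = partial_isometry l P Q \<bullet> outer (U $ i) (V $ i)" for i
  have t: "t i \<le> 1" "- 1 \<le> t i" for i
    unfolding t_def by (rule partial_isometry_inner_outer_orthonormal_le[OF PQ U V])+
  consider "l \<le> j" | "j < l" "l < r" | "r \<le> l" by linarith
  then show "partial_isometry l P Q \<bullet> (spectral_sum s U V + D) \<le> leading_sum l x"
  proof cases
    case 1
    show ?thesis
    proof (cases l)
      case 0
      then show ?thesis by (simp add: partial_isometry_def)
    next
      case (Suc l')
      \<comment> \<open>The entries \<open>a\<close> and \<open>b\<close> are raised by \<open>\<epsilon>\<close> and still do not exceed the entry at position \<open>l - 1\<close>.\<close>
      define \<kappa> where "\<kappa> = (\<chi> i. s $ i + (if i = a then \<epsilon> else 0) + (if i = b then \<epsilon> else 0))"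
      have "l' < CARD('n)" using ab(2) pos_less[of a] 1 Suc by linarith
      then obtain q :: 'n where q: "pos q = l'" using pos_surj by blast
      have "partial_isometry l P Q \<bullet> (X + D) \<le> leading_sum l \<kappa>"
      proof (rule ky_fan_weighted[OF U V PQ, where \<tau> = "s $ q"])
        show "0 \<le> s $ q" by (rule decreasingD(1)[OF s])
        show "s $ q \<le> \<kappa> $ i" if "pos i < l" for i
          using decreasingD(2)[OF s, of i q] that q Suc \<epsilon>(1) by (auto simp: \<kappa>_def)
        show "\<kappa> $ i \<le> s $ q" if i: "l \<le> pos i" for i
        proof (cases "i = a \<or> i = b")
          case True
          then have "s $ i + \<epsilon> \<le> s $ q" using ab 1 Suc q by (intro gap) auto
          then show ?thesis using True ab by (auto simp: \<kappa>_def)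
        next
          case False
          then show ?thesis using decreasingD(2)[OF s, of q i] i q Suc by (simp add: \<kappa>_def)
        qed
        fix y z
        define g where "g i = ((U $ i \<bullet> y)\<^sup>2 + (V $ i \<bullet> z)\<^sup>2) / 2" for i
        have "y \<bullet> ((X + D) *v z) = y \<bullet> (X *v z) + y \<bullet> (D *v z)"
          by (simp add: matrix_vector_mult_add_rdistrib inner_add_right)
        also have "\<dots> \<le> (\<Sum>i\<in>UNIV. s $ i * g i) + (\<epsilon> * g a + \<epsilon> * g b)"
          using form[of y z] spectral_sum_form_le[of s y U V z] decreasingD(1)[OF s]
          by (simp add: X_def g_def add_mono)
        also have "\<dots> = (\<Sum>i\<in>UNIV. \<kappa> $ i * g i)"
          by (simp add: \<kappa>_def distrib_right sum.distrib if_distrib[of "\<lambda>t. t * _"] cong: if_cong)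
        finally show "y \<bullet> ((X + D) *v z) \<le>
          (\<Sum>i\<in>UNIV. \<kappa> $ i * (((U $ i \<bullet> y)\<^sup>2 + (V $ i \<bullet> z)\<^sup>2) / 2))"
          by (simp add: g_def)
      qed
      also have "leading_sum l \<kappa> = leading_sum l s"
        unfolding leading_sum_def by (rule sum.cong) (use 1 ab in \<open>auto simp: \<kappa>_def\<close>)
      also have "\<dots> \<le> leading_sum l x" using 1 by (rule low)
      finally show ?thesis by (simp add: X_def)
    qed
  next
    case 2
    have "partial_isometry l P Q \<bullet> D \<le> \<epsilon> * ((1 - t a) + (1 - t b))"
      unfolding t_def by (rule trace[OF PQ])
    also have "\<dots> \<le> \<epsilon> * 4" using \<epsilon>(1) t(2)[of a] t(2)[of b] by (intro mult_left_mono) auto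
    finally have "partial_isometry l P Q \<bullet> (X + D) \<le> leading_sum l s + 4 * \<epsilon>"
      using ky_fan[OF s U V PQ, of l] by (simp add: inner_add_right X_def)
    then show ?thesis using slack[OF 2] by (simp add: X_def)
  next
    case 3
    have "partial_isometry l P Q \<bullet> X = (\<Sum>i\<in>UNIV. s $ i * t i)"
      by (simp add: X_def spectral_sum_def inner_sum_right t_def)
    moreover have "\<epsilon> * ((1 - t a) + (1 - t b)) \<le> (\<Sum>i\<in>UNIV. s $ i * (1 - t i))"
    proof -
      have "\<epsilon> * ((1 - t a) + (1 - t b)) \<le> s $ a * (1 - t a) + s $ b * (1 - t b)"
        unfolding distrib_left using \<epsilon>(2,3) t(1)[of a] t(1)[of b]
        by (intro add_mono mult_right_mono) auto
      also have "\<dots> = (\<Sum>i\<in>{a, b}. s $ i * (1 - t i))" using ab(1) by simp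
      also have "\<dots> \<le> (\<Sum>i\<in>UNIV. s $ i * (1 - t i))"
        by (rule sum_mono2) (use t(1) decreasingD(1)[OF s] in auto)
      finally show ?thesis .
    qed
    moreover have "partial_isometry l P Q \<bullet> D \<le> \<epsilon> * ((1 - t a) + (1 - t b))"
      unfolding t_def by (rule trace[OF PQ])
    ultimately have "partial_isometry l P Q \<bullet> (X + D) \<le> (\<Sum>i\<in>UNIV. s $ i)"
      by (simp add: inner_add_right right_diff_distrib sum_subtractf)
    then show ?thesis using total[OF 3] by (simp add: X_def)
  qed
qed

lemma abs_mult_le_mean_squares: "\<bar>a * b\<bar> \<le> (a\<^sup>2 + b\<^sup>2) / (2::real)"
  using mult_le_mean_squares[of "\<bar>a\<bar>" "\<bar>b\<bar>"] by (simp add: abs_mult)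

lemma scaled_le_abs:
  fixes \<delta> \<epsilon> t M :: real
  assumes "\<bar>\<delta>\<bar> \<le> \<epsilon>" "\<bar>t\<bar> \<le> M"
  shows "\<delta> * t \<le> \<epsilon> * M"
proof -
  have "\<delta> * t \<le> \<bar>\<delta>\<bar> * \<bar>t\<bar>" using abs_ge_self[of "\<delta> * t"] by (simp add: abs_mult)
  also have "\<dots> \<le> \<epsilon> * M" using assms by (intro mult_mono) auto
  finally show ?thesis .
qed

lemma diagonal_perturbation_bounds:
  fixes U P :: "real^'n^'n" and V Q :: "real^'p^'n" and a b :: 'n and \<delta> \<epsilon> :: real
  assumes U: "orthonormal_rows U" and V: "orthonormal_rows V" and \<delta>: "\<bar>\<delta>\<bar> \<le> \<epsilon>"
  defines "D \<equiv> \<delta> *\<^sub>R (outer (U $ a) (V $ a) - outer (U $ b) (V $ b))"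
  shows "y \<bullet> (D *v z) \<le> \<epsilon> * (((U $ a \<bullet> y)\<^sup>2 + (V $ a \<bullet> z)\<^sup>2) / 2) +
                         \<epsilon> * (((U $ b \<bullet> y)\<^sup>2 + (V $ b \<bullet> z)\<^sup>2) / 2)"
    and "orthonormal_rows P \<Longrightarrow> orthonormal_rows Q \<Longrightarrow>
      partial_isometry l P Q \<bullet> D \<le>
        \<epsilon> * ((1 - partial_isometry l P Q \<bullet> outer (U $ a) (V $ a)) +
             (1 - partial_isometry l P Q \<bullet> outer (U $ b) (V $ b)))"
proof -
  have "y \<bullet> (D *v z) = \<delta> * ((U $ a \<bullet> y) * (V $ a \<bullet> z) - (U $ b \<bullet> y) * (V $ b \<bullet> z))"
    by (simp add: D_def scaleR_matrix_vector_assoc[symmetric] matrix_vector_mult_diff_rdistrib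
        outer_mult inner_diff_right inner_commute algebra_simps)
  also have "\<dots> \<le> \<epsilon> * (((U $ a \<bullet> y)\<^sup>2 + (V $ a \<bullet> z)\<^sup>2) / 2 + ((U $ b \<bullet> y)\<^sup>2 + (V $ b \<bullet> z)\<^sup>2) / 2)"
    using abs_mult_le_mean_squares[of "U $ a \<bullet> y" "V $ a \<bullet> z"]
      abs_mult_le_mean_squares[of "U $ b \<bullet> y" "V $ b \<bullet> z"]
    by (intro scaled_le_abs[OF \<delta>]) linarith
  finally show "y \<bullet> (D *v z) \<le> \<epsilon> * (((U $ a \<bullet> y)\<^sup>2 + (V $ a \<bullet> z)\<^sup>2) / 2) +
                         \<epsilon> * (((U $ b \<bullet> y)\<^sup>2 + (V $ b \<bullet> z)\<^sup>2) / 2)"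
    by (simp only: distrib_left)
next
  assume PQ: "orthonormal_rows P" "orthonormal_rows Q"
  note t = partial_isometry_inner_outer_orthonormal_le[OF PQ U V]
  show "partial_isometry l P Q \<bullet> D \<le>
        \<epsilon> * ((1 - partial_isometry l P Q \<bullet> outer (U $ a) (V $ a)) +
             (1 - partial_isometry l P Q \<bullet> outer (U $ b) (V $ b)))"
    unfolding D_def inner_scaleR_right inner_diff_right
    using t(1)[of l a] t(1)[of l b] by (intro scaled_le_abs[OF \<delta>]) linarith
qed

text \<open>
  For the second bound, the perturbation is compared with the rank-one matrices built from
  \<open>u\<^sub>a \<plusminus> u\<^sub>b\<close> and \<open>v\<^sub>a \<plusminus> v\<^sub>b\<close>: each pairs to at most \<open>2\<close> with a partial isometry and
  is the sum of the two diagonal terms and \<open>\<plusminus>\<close> the off-diagonal pair.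
\<close>
lemma off_diagonal_perturbation_bounds:
  fixes U P :: "real^'n^'n" and V Q :: "real^'p^'n" and a b :: 'n and \<delta> \<epsilon> :: real
  assumes U: "orthonormal_rows U" and V: "orthonormal_rows V" and \<delta>: "\<bar>\<delta>\<bar> \<le> \<epsilon>" and "a \<noteq> b"
  defines "D \<equiv> \<delta> *\<^sub>R (outer (U $ a) (V $ b) + outer (U $ b) (V $ a))"
  shows "y \<bullet> (D *v z) \<le> \<epsilon> * (((U $ a \<bullet> y)\<^sup>2 + (V $ a \<bullet> z)\<^sup>2) / 2) +
                         \<epsilon> * (((U $ b \<bullet> y)\<^sup>2 + (V $ b \<bullet> z)\<^sup>2) / 2)"
    and "orthonormal_rows P \<Longrightarrow> orthonormal_rows Q \<Longrightarrow>
      partial_isometry l P Q \<bullet> D \<le>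
        \<epsilon> * ((1 - partial_isometry l P Q \<bullet> outer (U $ a) (V $ a)) +
             (1 - partial_isometry l P Q \<bullet> outer (U $ b) (V $ b)))"
proof -
  have "y \<bullet> (D *v z) = \<delta> * ((U $ a \<bullet> y) * (V $ b \<bullet> z) + (U $ b \<bullet> y) * (V $ a \<bullet> z))"
    by (simp add: D_def scaleR_matrix_vector_assoc[symmetric] matrix_vector_mult_add_rdistrib
        outer_mult inner_add_right inner_commute algebra_simps)
  also have "\<dots> \<le> \<epsilon> * (((U $ a \<bullet> y)\<^sup>2 + (V $ a \<bullet> z)\<^sup>2) / 2 + ((U $ b \<bullet> y)\<^sup>2 + (V $ b \<bullet> z)\<^sup>2) / 2)"
    using abs_mult_le_mean_squares[of "U $ a \<bullet> y" "V $ b \<bullet> z"]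
      abs_mult_le_mean_squares[of "U $ b \<bullet> y" "V $ a \<bullet> z"]
    unfolding add_divide_distrib by (intro scaled_le_abs[OF \<delta>]) linarith
  finally show "y \<bullet> (D *v z) \<le> \<epsilon> * (((U $ a \<bullet> y)\<^sup>2 + (V $ a \<bullet> z)\<^sup>2) / 2) +
                         \<epsilon> * (((U $ b \<bullet> y)\<^sup>2 + (V $ b \<bullet> z)\<^sup>2) / 2)"
    by (simp only: distrib_left)
next
  assume PQ: "orthonormal_rows P" "orthonormal_rows Q"
  define W where "W = partial_isometry l P Q"
  define q where "q = W \<bullet> outer (U $ a) (V $ b) + W \<bullet> outer (U $ b) (V $ a)"
  have *: "W \<bullet> outer (U $ a) (V $ a) + W \<bullet> outer (U $ b) (V $ b) + c * q \<le> 2" if "c = 1 \<or> c = - 1" for c :: real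
  proof -
    let ?y = "U $ a + c *\<^sub>R U $ b" and ?z = "V $ a + c *\<^sub>R V $ b"
    have cc: "c * c = 1" using that by auto
    have "?y \<bullet> ?y = 2" "?z \<bullet> ?z = 2"
      using \<open>a \<noteq> b\<close> cc
      by (simp_all add: inner_add_left inner_add_right orthonormal_rowsD[OF U] orthonormal_rowsD[OF V])
    then have "W \<bullet> outer ?y ?z \<le> 2"
      using partial_isometry_inner_outer_le[OF PQ, of l ?y ?z] by (simp add: W_def)
    moreover have "W \<bullet> outer ?y ?z =
        W \<bullet> outer (U $ a) (V $ a) + c * q + (c * c) * (W \<bullet> outer (U $ b) (V $ b))"
      by (simp add: q_def outer_add_left outer_add_right outer_scaleR_left outer_scaleR_right
          inner_add_right algebra_simps)
    ultimately show ?thesis using cc by simp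
  qed
  show "partial_isometry l P Q \<bullet> D \<le>
        \<epsilon> * ((1 - partial_isometry l P Q \<bullet> outer (U $ a) (V $ a)) +
             (1 - partial_isometry l P Q \<bullet> outer (U $ b) (V $ b)))"
    unfolding D_def inner_scaleR_right inner_add_right W_def[symmetric] q_def[symmetric]
    using *[of 1] *[of "-1"] by (intro scaled_le_abs[OF \<delta>]) (auto simp: abs_le_iff)
qed

text \<open>
  The block \<open>B\<close> consists of the positions from the last tight order \<open>j\<close> below the rank up to the rank.
  Since \<open>j < k\<close>, it has at least \<open>rank X - k + 1\<close> elements. Maximality of \<open>j\<close> gives the slack, tightness
  at \<open>j\<close> the gap between the singular values at positions \<open>j - 1\<close> and \<open>j\<close>.
\<close>
lemma perturbation_block:
  fixes X :: "real^'p^'n"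
  assumes np: "CARD('n) \<le> CARD('p)" and x: "decreasing x" "supported_within k x"
    and dom: "dominated x X" and rank: "k < rank X"
  obtains U :: "real^'n^'n" and V :: "real^'p^'n" and B :: "'n set" and \<epsilon> :: real
  where "orthonormal_rows U" "orthonormal_rows V" "rank X + 1 \<le> card B + k" "0 < \<epsilon>"
    "\<And>a b \<delta>. a \<in> B \<Longrightarrow> b \<in> B \<Longrightarrow> a \<noteq> b \<Longrightarrow> \<bar>\<delta>\<bar> \<le> \<epsilon> \<Longrightarrow>
       dominated x (X + \<delta> *\<^sub>R (outer (U $ a) (V $ a) - outer (U $ b) (V $ b)))"
    "\<And>a b \<delta>. a \<in> B \<Longrightarrow> b \<in> B \<Longrightarrow> a \<noteq> b \<Longrightarrow> \<bar>\<delta>\<bar> \<le> \<epsilon> \<Longrightarrow>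
       dominated x (X + \<delta> *\<^sub>R (outer (U $ a) (V $ b) + outer (U $ b) (V $ a)))"
proof -
  obtain s U V where s: "decreasing s" and U: "orthonormal_rows U" and V: "orthonormal_rows V"
    and X: "X = spectral_sum s U V"
    using svd[OF np] .
  define r where "r = rank X"
  have r: "r = card {i. s $ i \<noteq> 0}" by (simp add: r_def X rank_spectral_sum[OF U V])
  have rn: "r \<le> CARD('n)" unfolding r by (rule card_mono) auto
  have supp: "s $ i \<noteq> 0 \<longleftrightarrow> pos i < r" for i unfolding r by (rule decreasing_support[OF s])
  have s_sup: "supported_within r s" using supp by (force simp: supported_within_def)
  have le: "leading_sum l s \<le> leading_sum l x" for l
    using dom ky_fan_attained[OF U V, of l s] U V unfolding dominated_def X by metis
  \<comment> \<open>Beyond \<open>k\<close> the sums of \<open>x\<close> stay constant, whereas those of \<open>s\<close> grow as long as entries are positive.\<close>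
  have strict: "leading_sum l s < leading_sum l x" if l: "k \<le> l" "l < r" for l
  proof -
    obtain i :: 'n where i: "pos i = l" using pos_surj[of l, where 'a='n] l rn by auto
    have "0 < s $ i" using supp[of i] decreasingD(1)[OF s, of i] i l by simp
    then have "leading_sum l s < leading_sum (Suc l) s" by (simp add: leading_sum_Suc[OF i])
    also have "\<dots> \<le> leading_sum r s" using l by (intro leading_sum_mono decreasingD(1)[OF s]) auto
    also have "\<dots> \<le> leading_sum r x" by (rule le)
    also have "\<dots> = leading_sum l x" using l by (simp add: leading_sum_supported[OF x(2)])
    finally show ?thesis .
  qed
  define T where "T = {l. l < r \<and> leading_sum l s = leading_sum l x}"
  define j where "j = Max T"
  have T: "finite T" "T \<noteq> {}" using rank by (auto simp: T_def r_def intro: exI[of _ 0])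
  have jT: "j \<in> T" unfolding j_def using T by (rule Max_in)
  have jr: "j < r" and jeq: "leading_sum j s = leading_sum j x" using jT by (auto simp: T_def)
  have jk: "j < k" using strict[of j] jr jeq by force
  have after: "leading_sum l s < leading_sum l x" if "j < l" "l < r" for l
  proof -
    have "l \<notin> T" using Max_ge[OF T(1), of l] that(1) by (auto simp: j_def)
    then show ?thesis using le[of l] that(2) by (auto simp: T_def)
  qed
  obtain \<epsilon>1 where \<epsilon>1: "0 < \<epsilon>1" "\<And>i i'. pos i < j \<Longrightarrow> j \<le> pos i' \<Longrightarrow> s $ i' + \<epsilon>1 \<le> s $ i"
  proof (cases j)
    case 0
    then show ?thesis using that[of 1] by simp
  next
    case (Suc j')
    obtain p q :: 'n where p: "pos p = j'" and q: "pos q = j"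
      using pos_surj[of j', where 'a='n] pos_surj[of j, where 'a='n] jr rn Suc by auto
    \<comment> \<open>Tight at \<open>j\<close>, valid at \<open>j - 1\<close>, strict at \<open>j + 1\<close>: thus \<open>s\<close> is at least \<open>x\<close> at \<open>j - 1\<close>, below \<open>x\<close> at \<open>j\<close>.\<close>
    have "x $ p \<le> s $ p"
      using jeq le[of j'] by (simp add: Suc leading_sum_Suc[OF p])
    moreover have "s $ q < x $ q"
      using after[of "Suc j"] jk rank by (simp add: leading_sum_Suc[OF q] jeq r_def)
    moreover have "x $ q \<le> x $ p" using decreasingD(2)[OF x(1)] p q Suc by simp
    ultimately have "0 < s $ p - s $ q" by simp
    moreover have "s $ i' + (s $ p - s $ q) \<le> s $ i" if "pos i < j" "j \<le> pos i'" for i i'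
      using decreasingD(2)[OF s, of i p] decreasingD(2)[OF s, of q i'] that p q Suc by simp
    ultimately show ?thesis by (rule that)
  qed
  obtain \<epsilon>2 where \<epsilon>2: "0 < \<epsilon>2" "\<And>l. j < l \<Longrightarrow> l < r \<Longrightarrow> leading_sum l s + 4 * \<epsilon>2 \<le> leading_sum l x"
  proof -
    define M where "M = insert 1 ((\<lambda>l. (leading_sum l x - leading_sum l s) / 4) ` {j<..<r})"
    have "0 < Min M" unfolding M_def using after by (subst Min_gr_iff) auto
    moreover have "Min M \<le> (leading_sum l x - leading_sum l s) / 4" if "j < l" "l < r" for l
      using that by (intro Min_le) (auto simp: M_def)
    ultimately show ?thesis using that[of "Min M"] by (simp add: field_simps)
  qed
  obtain \<epsilon>3 where \<epsilon>3: "0 < \<epsilon>3" "\<And>i. pos i < r \<Longrightarrow> \<epsilon>3 \<le> s $ i"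
  proof -
    define M where "M = insert 1 ((\<lambda>i. s $ i) ` {i. pos i < r})"
    have "0 < s $ i" if "pos i < r" for i
      using supp[of i] decreasingD(1)[OF s, of i] that by simp
    then have "0 < Min M" unfolding M_def by (subst Min_gr_iff) auto
    moreover have "Min M \<le> s $ i" if "pos i < r" for i
      using that by (intro Min_le) (auto simp: M_def)
    ultimately show ?thesis by (rule that)
  qed
  define \<epsilon> where "\<epsilon> = min \<epsilon>1 (min \<epsilon>2 \<epsilon>3)"
  have \<epsilon>: "0 < \<epsilon>" "\<epsilon> \<le> \<epsilon>1" "\<epsilon> \<le> \<epsilon>2" "\<epsilon> \<le> \<epsilon>3" using \<epsilon>1 \<epsilon>2 \<epsilon>3 by (auto simp: \<epsilon>_def)
  define B where "B = {i::'n. pos i < r} - {i. pos i < j}"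
  have "card B = r - j"
    unfolding B_def using jr rn by (subst card_Diff_subset) (auto simp: card_pos_less)
  then have card: "rank X + 1 \<le> card B + k" using jr jk rank by (simp add: r_def)
  have dom': "dominated x (X + D)"
    if ab: "a \<in> B" "b \<in> B" "a \<noteq> b"
      and D: "\<And>y z. y \<bullet> (D *v z) \<le> \<epsilon> * (((U $ a \<bullet> y)\<^sup>2 + (V $ a \<bullet> z)\<^sup>2) / 2) +
                         \<epsilon> * (((U $ b \<bullet> y)\<^sup>2 + (V $ b \<bullet> z)\<^sup>2) / 2)"
      "\<And>l P Q. orthonormal_rows P \<Longrightarrow> orthonormal_rows Q \<Longrightarrow>
      partial_isometry l P Q \<bullet> D \<le>
        \<epsilon> * ((1 - partial_isometry l P Q \<bullet> outer (U $ a) (V $ a)) +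
             (1 - partial_isometry l P Q \<bullet> outer (U $ b) (V $ b)))" for a b D
    unfolding X
  proof (rule dominated_perturbation[OF s U V _ _ _ ab(3), where j = j and r = r and \<epsilon> = \<epsilon>])
    show "0 \<le> \<epsilon>" using \<epsilon> by simp
    show "\<epsilon> \<le> s $ a" "\<epsilon> \<le> s $ b" using \<epsilon>3(2)[of a] \<epsilon>3(2)[of b] \<epsilon> ab by (auto simp: B_def)
    show "j \<le> pos a" "j \<le> pos b" using ab by (auto simp: B_def)
    show "s $ i' + \<epsilon> \<le> s $ i" if "pos i < j" "j \<le> pos i'" for i i'
      using \<epsilon>1(2)[OF that] \<epsilon> by simp
    show "leading_sum l s \<le> leading_sum l x" for l by (rule le)
    show "leading_sum l s + 4 * \<epsilon> \<le> leading_sum l x" if "j < l" "l < r" for l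
      using \<epsilon>2(2)[OF that] \<epsilon> by simp
    show "(\<Sum>i\<in>UNIV. s $ i) \<le> leading_sum l x" if "r \<le> l" for l
      using le[of l] that by (simp add: leading_sum_supported[OF s_sup])
  qed (fact D)+
  show ?thesis
  proof (rule that[OF U V card \<epsilon>(1)])
    fix a b \<delta> assume ab: "a \<in> B" "b \<in> B" "a \<noteq> b" and \<delta>: "\<bar>\<delta>\<bar> \<le> \<epsilon>"
    show "dominated x (X + \<delta> *\<^sub>R (outer (U $ a) (V $ a) - outer (U $ b) (V $ b)))"
      by (rule dom'[OF ab diagonal_perturbation_bounds[OF U V \<delta>]])
    show "dominated x (X + \<delta> *\<^sub>R (outer (U $ a) (V $ b) + outer (U $ b) (V $ a)))"
      by (rule dom'[OF ab off_diagonal_perturbation_bounds[OF U V \<delta> ab(3)]])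
  qed
qed

section \<open>Counting two-sided directions\<close>

text \<open>
  If \<open>K\<close> is convex and contains \<open>x\<close>, this is the linear space parallel to the smallest face of \<open>K\<close>
  that contains \<open>x\<close>.
\<close>
definition two_sided_directions :: "'a::real_vector set \<Rightarrow> 'a \<Rightarrow> 'a set" where
  "two_sided_directions K x = {d. \<exists>\<epsilon>>0. x + \<epsilon> *\<^sub>R d \<in> K \<and> x - \<epsilon> *\<^sub>R d \<in> K}"

lemma two_sided_directionsI:
  assumes "0 < \<epsilon>" "\<And>\<delta>. \<bar>\<delta>\<bar> \<le> \<epsilon> \<Longrightarrow> x + \<delta> *\<^sub>R d \<in> K"
  shows "d \<in> two_sided_directions K x"
  using assms(1) assms(2)[of \<epsilon>] assms(2)[of "- \<epsilon>"] by (auto simp: two_sided_directions_def)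

lemma convex_shorter_step:
  assumes "convex K" "x \<in> K" "x + \<epsilon> *\<^sub>R d \<in> K" "0 \<le> \<delta>" "\<delta> \<le> \<epsilon>" "0 < \<epsilon>"
  shows "x + \<delta> *\<^sub>R d \<in> K"
proof -
  have "(1 - \<delta> / \<epsilon>) *\<^sub>R x + (\<delta> / \<epsilon>) *\<^sub>R (x + \<epsilon> *\<^sub>R d) \<in> K"
    using assms by (intro convexD_alt) auto
  then show ?thesis using assms by (simp add: algebra_simps)
qed

lemma subspace_two_sided_directions:
  assumes K: "convex K" and x: "x \<in> K"
  shows "subspace (two_sided_directions K x)"
proof (rule subspaceI)
  show "0 \<in> two_sided_directions K x" using x by (intro two_sided_directionsI[of 1]) auto
next
  fix d e assume "d \<in> two_sided_directions K x" "e \<in> two_sided_directions K x"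
  then obtain \<delta> \<epsilon> where d: "0 < \<delta>" "x + \<delta> *\<^sub>R d \<in> K" "x - \<delta> *\<^sub>R d \<in> K"
    and e: "0 < \<epsilon>" "x + \<epsilon> *\<^sub>R e \<in> K" "x - \<epsilon> *\<^sub>R e \<in> K"
    by (auto simp: two_sided_directions_def)
  define m where "m = min \<delta> \<epsilon>"
  have m: "0 < m" "m \<le> \<delta>" "m \<le> \<epsilon>" using d e by (auto simp: m_def)
  have "x + m *\<^sub>R d \<in> K" "x + m *\<^sub>R e \<in> K" "x + m *\<^sub>R (- d) \<in> K" "x + m *\<^sub>R (- e) \<in> K"
    using convex_shorter_step[OF K x, of \<delta> d m] convex_shorter_step[OF K x, of \<epsilon> e m]
      convex_shorter_step[OF K x, of \<delta> "- d" m] convex_shorter_step[OF K x, of \<epsilon> "- e" m] d e m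
    by auto
  then have "(1 - 1/2) *\<^sub>R (x + m *\<^sub>R d) + (1/2) *\<^sub>R (x + m *\<^sub>R e) \<in> K"
    "(1 - 1/2) *\<^sub>R (x + m *\<^sub>R (- d)) + (1/2) *\<^sub>R (x + m *\<^sub>R (- e)) \<in> K"
    by - (rule convexD_alt[OF K]; simp)+
  moreover have "(1 - 1/2) *\<^sub>R (x + m *\<^sub>R d) + (1/2) *\<^sub>R (x + m *\<^sub>R e) = x + (m / 2) *\<^sub>R (d + e)"
    "(1 - 1/2) *\<^sub>R (x + m *\<^sub>R (- d)) + (1/2) *\<^sub>R (x + m *\<^sub>R (- e)) = x - (m / 2) *\<^sub>R (d + e)"
    by (simp_all add: algebra_simps flip: scaleR_add_left)
  ultimately show "d + e \<in> two_sided_directions K x"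
    using m(1) unfolding two_sided_directions_def by (auto intro!: exI[of _ "m / 2"])
next
  fix c :: real and d assume "d \<in> two_sided_directions K x"
  then obtain \<delta> where d: "0 < \<delta>" "x + \<delta> *\<^sub>R d \<in> K" "x - \<delta> *\<^sub>R d \<in> K"
    by (auto simp: two_sided_directions_def)
  show "c *\<^sub>R d \<in> two_sided_directions K x"
  proof (cases "c = 0")
    case True
    then show ?thesis using x by (intro two_sided_directionsI[of 1]) auto
  next
    case False
    show ?thesis unfolding two_sided_directions_def
    proof (intro CollectI exI[of _ "\<delta> / \<bar>c\<bar>"] conjI)
      show "0 < \<delta> / \<bar>c\<bar>" using d False by simp
      show "x + (\<delta> / \<bar>c\<bar>) *\<^sub>R c *\<^sub>R d \<in> K" "x - (\<delta> / \<bar>c\<bar>) *\<^sub>R c *\<^sub>R d \<in> K"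
        using d False by (cases "c > 0"; simp)+
    qed
  qed
qed

text \<open>The ordered pairs and their mirror images cover \<open>B \<times> B\<close> and overlap in the diagonal.\<close>
lemma card_ordered_pairs:
  fixes B :: "'a::finite set"
  shows "2 * card {(a, b) \<in> B \<times> B. pos a \<le> pos b} = card B * (card B + 1)"
proof -
  define I where "I = {(a, b) \<in> B \<times> B. pos a \<le> pos b}"
  define I' where "I' = {(a, b) \<in> B \<times> B. pos b \<le> pos a}"
  have fin: "finite I" "finite I'" by simp_all
  have "I' = prod.swap ` I" by (auto simp: I_def I'_def image_iff)
  then have "card I' = card I" by (simp add: card_image)
  moreover have "I \<union> I' = B \<times> B" by (auto simp: I_def I'_def)
  moreover have "I \<inter> I' = (\<lambda>a. (a, a)) ` B" by (auto simp: I_def I'_def image_iff)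
  then have "card (I \<inter> I') = card B" by (simp add: card_image inj_on_def)
  ultimately have "2 * card I = card B * card B + card B"
    using card_Un_Int[OF fin] by (simp add: card_cartesian_product)
  then show ?thesis by (simp add: I_def)
qed

text \<open>
  One more vector, the matrix unit \<open>E c c\<close>, completes the traceless symmetric matrices to all symmetric
  ones, and these have the pairwise orthogonal basis \<open>E a b + E b a\<close> indexed by ordered pairs.
\<close>
lemma dim_symmetric_traceless:
  fixes U :: "real^'n^'n" and V :: "real^'p^'n"
  assumes U: "orthonormal_rows U" and V: "orthonormal_rows V"
    and T: "\<And>a b. a \<in> B \<Longrightarrow> b \<in> B \<Longrightarrow> a \<noteq> b \<Longrightarrow> outer (U $ a) (V $ a) - outer (U $ b) (V $ b) \<in> T"
      "\<And>a b. a \<in> B \<Longrightarrow> b \<in> B \<Longrightarrow> a \<noteq> b \<Longrightarrow> outer (U $ a) (V $ b) + outer (U $ b) (V $ a) \<in> T"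
  shows "card B * (card B + 1) \<le> 2 * (dim T + 1)"
proof (cases "B = {}")
  case False
  then obtain c where c: "c \<in> B" by blast
  define E where "E a b = outer (U $ a) (V $ b)" for a b
  define \<phi> where "\<phi> = (\<lambda>(a, b). E a b + E b a)"
  define I where "I = {(a, b) \<in> B \<times> B. pos a \<le> pos b}"
  have E: "E a b \<bullet> E a' b' = (if a = a' \<and> b = b' then 1 else 0)" for a b a' b'
    by (simp add: E_def inner_outer_outer orthonormal_rowsD[OF U] orthonormal_rowsD[OF V])
  have orth: "\<phi> p \<bullet> \<phi> q = 0" if "p \<in> I" "q \<in> I" "p \<noteq> q" for p q
  proof -
    obtain a b a' b' where pq: "p = (a, b)" "q = (a', b')" by (cases p, cases q)
    have "\<not> (a = a' \<and> b = b')" using that(3) pq by auto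
    moreover have "\<not> (a = b' \<and> b = a')"
    proof
      assume *: "a = b' \<and> b = a'"
      then have "pos a = pos b" using that(1,2) pq by (simp add: I_def)
      then have "a = b" by simp
      then show False using * that(3) pq by simp
    qed
    ultimately have "E a b \<bullet> E a' b' = 0" "E a b \<bullet> E b' a' = 0" "E b a \<bullet> E a' b' = 0" "E b a \<bullet> E b' a' = 0"
      unfolding E by (auto split: if_split)
    then show ?thesis by (simp add: \<phi>_def pq inner_add_left inner_add_right)
  qed
  have pos: "0 < \<phi> p \<bullet> \<phi> p" for p
  proof -
    obtain a b where p: "p = (a, b)" by (cases p)
    have "\<phi> p \<bullet> \<phi> p = 2 * (1 + (if a = b then 1 else 0))"
      unfolding \<phi>_def p prod.case inner_add_left inner_add_right E by auto
    then show ?thesis by simp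
  qed
  have inj: "inj_on \<phi> I" using orth pos by (metis inj_onI less_irrefl)
  have "pairwise orthogonal (\<phi> ` I)" "0 \<notin> \<phi> ` I"
  proof -
    show "pairwise orthogonal (\<phi> ` I)"
      unfolding pairwise_def orthogonal_def using orth by blast
    show "0 \<notin> \<phi> ` I" using pos by (metis image_iff inner_zero_left less_irrefl)
  qed
  then have ind: "independent (\<phi> ` I)" by (rule pairwise_orthogonal_independent)
  let ?W = "insert (E c c) T"
  have diag: "E a a \<in> span ?W" if "a \<in> B" for a
  proof (cases "a = c")
    case False
    then have "E a a - E c c \<in> span ?W" using T(1)[OF that c] by (intro span_base) (simp add: E_def)
    then have "(E a a - E c c) + E c c \<in> span ?W" by (intro span_add) (auto intro: span_base)
    then show ?thesis by simp
  qed (auto intro: span_base)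
  have "\<phi> (a, b) \<in> span ?W" if "(a, b) \<in> I" for a b
  proof (cases "a = b")
    case True
    then have "b \<in> B" using that by (simp add: I_def)
    then show ?thesis unfolding \<phi>_def prod.case True by (intro span_add diag)
  next
    case False
    then show ?thesis using that T(2)[of a b] by (auto simp: \<phi>_def I_def E_def intro: span_base)
  qed
  then have "\<phi> ` I \<subseteq> span ?W" by auto
  then have "card (\<phi> ` I) \<le> dim (span ?W)" using ind by (rule independent_card_le_dim)
  also have "\<dots> \<le> dim T + 1" by (simp add: dim_insert)
  finally have "card I \<le> dim T + 1" by (simp add: card_image[OF inj])
  then show ?thesis using card_ordered_pairs[of B] by (simp add: I_def)
qed auto

text \<open>The orthogonal complement of \<open>S\<close> is too large to meet \<open>T\<close> trivially.\<close>
lemma exists_orthogonal_direction: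
  fixes T S :: "'a::euclidean_space set"
  assumes T: "subspace T" and dim: "dim S < dim T"
  obtains d where "d \<in> T" "d \<noteq> 0" "\<And>a. a \<in> S \<Longrightarrow> a \<bullet> d = 0"
proof -
  define C where "C = {y \<in> UNIV. \<forall>a\<in>span S. orthogonal a y}"
  have C: "dim C + dim S = DIM('a)"
    unfolding C_def using dim_subspace_orthogonal_to_vectors[of "span S" UNIV] by (simp add: dim_UNIV)
  have sC: "subspace C"
    by (auto simp: C_def subspace_def orthogonal_clauses orthogonal_def inner_add_right)
  have "dim {x + y |x y. x \<in> T \<and> y \<in> C} + dim (T \<inter> C) = dim T + dim C"
    by (rule dim_sums_Int[OF T sC])
  moreover have "dim {x + y |x y. x \<in> T \<and> y \<in> C} \<le> DIM('a)" by (rule dim_subset_UNIV)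
  ultimately have "0 < dim (T \<inter> C)" using C dim by linarith
  then obtain d where "d \<in> T \<inter> C" "d \<noteq> 0" by (metis dim_eq_0 not_gr0 singletonI subsetI)
  then show ?thesis using that by (auto simp: C_def orthogonal_def span_base)
qed

text \<open>
  Otherwise some two-sided direction is orthogonal to all \<open>A i\<close>. Moving along it keeps the side
  constraints, so the extreme point would be the midpoint of two feasible points.
\<close>
lemma dim_two_sided_directions_le:
  fixes A :: "nat \<Rightarrow> real^'p^'n"
  assumes X: "X extreme_point_of (lsopr_feasible f k m A bl bu)"
  shows "dim (two_sided_directions (convex hull (domain_set f k)) X) \<le> dim (A ` {1..m})"
proof (rule ccontr)
  let ?F = "lsopr_feasible f k m A bl bu" and ?K = "convex hull (domain_set f k) :: (real^'p^'n) set"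
  assume "\<not> ?thesis"
  then have less: "dim (A ` {1..m}) < dim (two_sided_directions ?K X)" by simp
  have XF: "X \<in> ?F" using X by (simp add: extreme_point_of_def)
  then have "X \<in> ?K" by (simp add: lsopr_feasible_def)
  then have "subspace (two_sided_directions ?K X)"
    by (intro subspace_two_sided_directions convex_convex_hull)
  then obtain d where d: "d \<in> two_sided_directions ?K X" "d \<noteq> 0" "\<And>a. a \<in> A ` {1..m} \<Longrightarrow> a \<bullet> d = 0"
    using exists_orthogonal_direction[OF _ less] by blast
  then obtain \<epsilon> where \<epsilon>: "0 < \<epsilon>" "X + \<epsilon> *\<^sub>R d \<in> ?K" "X - \<epsilon> *\<^sub>R d \<in> ?K"
    by (auto simp: two_sided_directions_def)
  then have "X + \<epsilon> *\<^sub>R d \<in> ?F" "X - \<epsilon> *\<^sub>R d \<in> ?F"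
    using XF d(3) by (auto simp: lsopr_feasible_def inner_add_right inner_diff_right)
  moreover have "X \<in> open_segment (X + \<epsilon> *\<^sub>R d) (X - \<epsilon> *\<^sub>R d)"
    unfolding in_segment
  proof (intro conjI exI[of _ "1/2"])
    show "X + \<epsilon> *\<^sub>R d \<noteq> X - \<epsilon> *\<^sub>R d"
    proof
      assume "X + \<epsilon> *\<^sub>R d = X - \<epsilon> *\<^sub>R d"
      then have "(2 * \<epsilon>) *\<^sub>R d = 0" by (simp add: algebra_simps flip: scaleR_2)
      then show False using d(2) \<epsilon>(1) by simp
    qed
    show "X = (1 - 1/2) *\<^sub>R (X + \<epsilon> *\<^sub>R d) + (1/2) *\<^sub>R (X - \<epsilon> *\<^sub>R d)"
      by (simp add: algebra_simps flip: scaleR_add_left)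
  qed auto
  ultimately show False using X by (auto simp: extreme_point_of_def)
qed

lemma le_floor_sqrt_bound:
  assumes "s * (s + 3) \<le> 2 * m"
  shows "int s \<le> \<lfloor>sqrt (2 * real m + 9/4) - 3/2\<rfloor>"
proof -
  have "real (s * (s + 3)) \<le> real (2 * m)" using assms by (rule of_nat_mono)
  then have "(real s + 3/2)\<^sup>2 \<le> 2 * real m + 9/4"
    by (simp add: power2_eq_square algebra_simps)
  then have "real s + 3/2 \<le> sqrt (2 * real m + 9/4)" by (rule real_le_rsqrt)
  then show ?thesis by (simp add: le_floor_iff)
qed

text \<open>
  With \<open>s\<close> the excess of the rank over \<open>k\<close>, the block of \<open>perturbation_block\<close> has at least \<open>s + 1\<close>
  elements, hence \<open>(s + 1) (s + 2) \<le> 2 (m + 1)\<close>.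
\<close>
lemma rank_bound_if_few_directions:
  fixes X :: "real^'p^'n"
  assumes np: "CARD('n) \<le> CARD('p)" and cvx: "convex_on UNIV f"
    and sym: "symmetric_fun f" and sgn: "sign_invariant f"
    and X: "X \<in> convex hull (domain_set f k)"
    and dim: "dim (two_sided_directions (convex hull (domain_set f k)) X) \<le> m"
  shows "int (rank X) \<le> int k + \<lfloor>sqrt (2 * real m + 9/4) - 3/2\<rfloor>"
proof -
  note hull = convex_hull_domain_set[OF np cvx sym sgn]
  let ?K = "convex hull (domain_set f k) :: (real^'p^'n) set"
  define s where "s = rank X - k"
  have "s * (s + 3) \<le> 2 * m"
  proof (cases "k < rank X")
    case True
    obtain x where x: "decreasing x" "supported_within k x" "f x \<le> 0" "dominated x X"
      using X unfolding hull by blast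
    have K: "Z \<in> ?K" if "dominated x Z" for Z unfolding hull using x that by blast
    obtain U :: "real^'n^'n" and V :: "real^'p^'n" and B :: "'n set" and \<epsilon> :: real
      where UV: "orthonormal_rows U" "orthonormal_rows V"
        and B: "rank X + 1 \<le> card B + k" and \<epsilon>: "0 < \<epsilon>"
        and diag: "\<And>a b \<delta>. a \<in> B \<Longrightarrow> b \<in> B \<Longrightarrow> a \<noteq> b \<Longrightarrow> \<bar>\<delta>\<bar> \<le> \<epsilon> \<Longrightarrow>
          dominated x (X + \<delta> *\<^sub>R (outer (U $ a) (V $ a) - outer (U $ b) (V $ b)))"
        and off: "\<And>a b \<delta>. a \<in> B \<Longrightarrow> b \<in> B \<Longrightarrow> a \<noteq> b \<Longrightarrow> \<bar>\<delta>\<bar> \<le> \<epsilon> \<Longrightarrow>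
          dominated x (X + \<delta> *\<^sub>R (outer (U $ a) (V $ b) + outer (U $ b) (V $ a)))"
      using perturbation_block[OF np x(1,2,4) True] by blast
    have "card B * (card B + 1) \<le> 2 * (dim (two_sided_directions ?K X) + 1)"
      using UV
    proof (rule dim_symmetric_traceless)
      fix a b assume ab: "a \<in> B" "b \<in> B" "a \<noteq> b"
      show "outer (U $ a) (V $ a) - outer (U $ b) (V $ b) \<in> two_sided_directions ?K X"
        by (rule two_sided_directionsI[OF \<epsilon>]) (rule K[OF diag[OF ab]])
      show "outer (U $ a) (V $ b) + outer (U $ b) (V $ a) \<in> two_sided_directions ?K X"
        by (rule two_sided_directionsI[OF \<epsilon>]) (rule K[OF off[OF ab]])
    qed
    also have "\<dots> \<le> 2 * (m + 1)" using dim by simp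
    finally have "card B * (card B + 1) \<le> 2 * (m + 1)" .
    moreover have "(s + 1) * (s + 2) \<le> card B * (card B + 1)"
      using B True by (intro mult_le_mono) (auto simp: s_def)
    ultimately have "(s + 1) * (s + 2) \<le> 2 * (m + 1)" by linarith
    then show ?thesis by (simp add: algebra_simps)
  qed (simp add: s_def)
  from le_floor_sqrt_bound[OF this] show ?thesis by (simp add: s_def)
qed

lemma strengthened_rank_properties:
  fixes f :: "real^'n \<Rightarrow> real"
  assumes "1 \<le> k"
  shows "1 \<le> strengthened_rank TYPE('p::finite) f k"
    and "convex hull (domain_set f k :: (real^'p^'n) set) =
         convex hull (domain_set f (strengthened_rank TYPE('p) f k))"
proof -
  let ?P = "\<lambda>r. 1 \<le> r \<and> r \<le> k \<and>
    convex hull (domain_set f k :: (real^'p^'n) set) = convex hull (domain_set f r)"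
  have "?P (strengthened_rank TYPE('p) f k)"
    unfolding strengthened_rank_def by (rule LeastI[of ?P k]) (use assms in simp)
  then show "1 \<le> strengthened_rank TYPE('p) f k"
    "convex hull (domain_set f k :: (real^'p^'n) set) =
         convex hull (domain_set f (strengthened_rank TYPE('p) f k))" by blast+
qed

lemma rank_extreme_point:
  fixes f :: "real^'n \<Rightarrow> real" and A :: "nat \<Rightarrow> real^'p^'n"
  assumes "1 \<le> k" and np: "CARD('n) \<le> CARD('p)" and cvx: "convex_on UNIV f"
    and sym: "symmetric_fun f" and sgn: "sign_invariant f"
    and X: "X extreme_point_of (lsopr_feasible f k m A bl bu)"
  shows "int (rank X) \<le> int (strengthened_rank TYPE('p) f k) +
    \<lfloor>sqrt (2 * real (dim (A ` {1..m})) + 9/4) - 3/2\<rfloor>"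
proof (rule rank_bound_if_few_directions[OF np cvx sym sgn])
  note eq = strengthened_rank_properties(2)[OF assms(1), of f, where 'p='p]
  show "X \<in> convex hull (domain_set f (strengthened_rank TYPE('p) f k))"
    using X by (simp add: eq[symmetric] extreme_point_of_def lsopr_feasible_def)
  show "dim (two_sided_directions (convex hull (domain_set f (strengthened_rank TYPE('p) f k))) X)
    \<le> dim (A ` {1..m})"
    using dim_two_sided_directions_le[OF X] by (simp add: eq[symmetric])
qed

section \<open>Linear programs attain a finite value\<close>

text \<open>
  Ratio test: among the constraints whose left-hand side increases along \<open>d\<close>, the one with the
  smallest quotient of remaining slack and rate of increase is hit first.
\<close>
lemma exists_hit_or_unbounded:
  fixes y d :: "'a::euclidean_space"
  assumes fin: "finite F" and F: "\<And>h. h \<in> F \<Longrightarrow> h = {x. a h \<bullet> x \<le> b h}"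
    and y: "y \<in> \<Inter>F" and tight: "\<And>h. h \<in> F \<Longrightarrow> a h \<bullet> y = b h \<Longrightarrow> a h \<bullet> d = 0"
  shows "(\<forall>t\<ge>0. y + t *\<^sub>R d \<in> \<Inter>F) \<or>
    (\<exists>t\<ge>0. y + t *\<^sub>R d \<in> \<Inter>F \<and> (\<exists>h\<in>F. a h \<bullet> y \<noteq> b h \<and> a h \<bullet> (y + t *\<^sub>R d) = b h))"
proof -
  have yF: "a h \<bullet> y \<le> b h" if "h \<in> F" for h using y F[OF that] that by blast
  have memI: "z \<in> \<Inter>F" if "\<And>h. h \<in> F \<Longrightarrow> a h \<bullet> z \<le> b h" for z
    using F that by blast
  define N where "N = {h \<in> F. 0 < a h \<bullet> d}"
  define \<tau> where "\<tau> h = (b h - a h \<bullet> y) / (a h \<bullet> d)" for h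
  show ?thesis
  proof (cases "N = {}")
    case True
    have "y + t *\<^sub>R d \<in> \<Inter>F" if "0 \<le> t" for t
    proof (rule memI)
      fix h assume h: "h \<in> F"
      then have "t * (a h \<bullet> d) \<le> 0" using True that by (force simp: N_def mult_nonneg_nonpos not_less)
      then show "a h \<bullet> (y + t *\<^sub>R d) \<le> b h" using yF[OF h] by (simp add: inner_add_right)
    qed
    then show ?thesis by blast
  next
    case False
    have finN: "finite N" using fin by (simp add: N_def)
    define t where "t = Min (\<tau> ` N)"
    have "t \<in> \<tau> ` N" unfolding t_def using finN False by (intro Min_in) auto
    then obtain h0 where h0: "h0 \<in> N" "t = \<tau> h0" by blast
    have t0: "0 \<le> t" unfolding h0(2) \<tau>_def using h0(1) yF[of h0] by (simp add: N_def)
    have "y + t *\<^sub>R d \<in> \<Inter>F"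
    proof (rule memI)
      fix h assume h: "h \<in> F"
      show "a h \<bullet> (y + t *\<^sub>R d) \<le> b h"
      proof (cases "h \<in> N")
        case True
        then have "t \<le> \<tau> h" unfolding t_def using finN by (intro Min_le) auto
        then show ?thesis using True by (simp add: \<tau>_def N_def inner_add_right field_simps)
      next
        case False
        then have "t * (a h \<bullet> d) \<le> 0" using t0 h by (simp add: N_def mult_nonneg_nonpos)
        then show ?thesis using yF[OF h] by (simp add: inner_add_right)
      qed
    qed
    moreover have "a h0 \<bullet> y \<noteq> b h0" using h0(1) tight[of h0] by (auto simp: N_def)
    moreover have "a h0 \<bullet> (y + t *\<^sub>R d) = b h0"
      using h0 by (simp add: \<tau>_def N_def inner_add_right)
    ultimately show ?thesis using t0 h0(1) by (auto simp: N_def)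
  qed
qed

text \<open>
  For \<open>x\<close> in \<open>S\<close>, take a point that is no worse and has the largest number of tight constraints. The
  objective is constant along all directions that keep these tight: descending along such a direction
  would either go on forever, against the lower bound, or make a further constraint tight. At points of
  this kind, collected in \<open>V\<close>, the value of the objective depends only on the set of tight constraints,
  so it takes finitely many values.
\<close>
theorem linear_attains_min_on_polyhedron:
  fixes S :: "'a::euclidean_space set"
  assumes poly: "polyhedron S" and "S \<noteq> {}" and bdd: "\<And>x. x \<in> S \<Longrightarrow> \<beta> \<le> c \<bullet> x"
  obtains x where "x \<in> S" "\<And>y. y \<in> S \<Longrightarrow> c \<bullet> x \<le> c \<bullet> y"
proof -
  obtain F where fin: "finite F" and S: "S = \<Inter>F" and "\<forall>h\<in>F. \<exists>a b. a \<noteq> 0 \<and> h = {x. a \<bullet> x \<le> b}"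
    using poly unfolding polyhedron_def by blast
  then obtain a b where F: "\<And>h. h \<in> F \<Longrightarrow> h = {x. a h \<bullet> x \<le> b h}" by metis
  define J where "J y = {h \<in> F. a h \<bullet> y = b h}" for y
  define V where "V = {y \<in> S. \<forall>d. (\<forall>h\<in>J y. a h \<bullet> d = 0) \<longrightarrow> c \<bullet> d = 0}"
  have improve: "\<exists>y\<in>V. c \<bullet> y \<le> c \<bullet> x" if x: "x \<in> S" for x
  proof -
    let ?P = "\<lambda>y. y \<in> S \<and> c \<bullet> y \<le> c \<bullet> x"
    have "\<exists>y. ?P y \<and> (\<forall>z. ?P z \<longrightarrow> card (J z) \<le> card (J y))"
      by (rule ex_has_greatest_nat[where b = "Suc (card F)" and k = x])
        (use x fin in \<open>auto simp: J_def less_Suc_eq_le intro: card_mono\<close>)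
    then obtain y where y: "y \<in> S" "c \<bullet> y \<le> c \<bullet> x"
      and max: "\<And>z. z \<in> S \<Longrightarrow> c \<bullet> z \<le> c \<bullet> x \<Longrightarrow> card (J z) \<le> card (J y)" by blast
    have no_descent: "\<not> c \<bullet> d < 0" if d: "\<And>h. h \<in> J y \<Longrightarrow> a h \<bullet> d = 0" for d
    proof
      assume neg: "c \<bullet> d < 0"
      have "\<not> (\<forall>t\<ge>0. y + t *\<^sub>R d \<in> S)"
      proof
        assume all: "\<forall>t\<ge>0. y + t *\<^sub>R d \<in> S"
        define t where "t = (c \<bullet> y - \<beta> + 1) / - (c \<bullet> d)"
        have "0 \<le> t" using bdd[OF y(1)] neg unfolding t_def by (intro divide_nonneg_pos) auto
        then have "\<beta> \<le> c \<bullet> y + t * (c \<bullet> d)"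
          using bdd[of "y + t *\<^sub>R d"] all by (simp add: inner_add_right)
        moreover have "t * (c \<bullet> d) = - (c \<bullet> y - \<beta> + 1)" using neg by (simp add: t_def field_simps)
        ultimately show False by simp
      qed
      then obtain t h where t: "0 \<le> t" "y + t *\<^sub>R d \<in> S"
        and h: "h \<in> F" "a h \<bullet> y \<noteq> b h" "a h \<bullet> (y + t *\<^sub>R d) = b h"
        using exists_hit_or_unbounded[OF fin F, of y d] y(1) d unfolding S J_def by blast
      have "c \<bullet> (y + t *\<^sub>R d) \<le> c \<bullet> x"
        using y(2) mult_nonneg_nonpos[OF t(1), of "c \<bullet> d"] neg by (simp add: inner_add_right)
      then have "card (J (y + t *\<^sub>R d)) \<le> card (J y)" using t(2) by (rule max[rotated])
      moreover have "insert h (J y) \<subseteq> J (y + t *\<^sub>R d)"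
        using h d by (auto simp: J_def inner_add_right)
      then have "card (insert h (J y)) \<le> card (J (y + t *\<^sub>R d))"
        by (intro card_mono) (use fin in \<open>auto simp: J_def\<close>)
      moreover have "card (insert h (J y)) = Suc (card (J y))"
        using h fin by (subst card_insert_disjoint) (auto simp: J_def)
      ultimately show False by simp
    qed
    have "c \<bullet> d = 0" if "\<forall>h\<in>J y. a h \<bullet> d = 0" for d
      using no_descent[of d] no_descent[of "- d"] that by force
    then have "y \<in> V" using y(1) by (simp add: V_def)
    then show ?thesis using y(2) by blast
  qed
  have same: "c \<bullet> y = c \<bullet> z" if "y \<in> V" "z \<in> V" "J y = J z" for y z
  proof -
    have "a h \<bullet> (y - z) = 0" if "h \<in> J y" for h
    proof -
      have "h \<in> J z" using that \<open>J y = J z\<close> by simp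
      then show ?thesis using that by (simp add: J_def inner_diff_right)
    qed
    then have "c \<bullet> (y - z) = 0" using \<open>y \<in> V\<close> by (simp add: V_def)
    then show ?thesis by (simp add: inner_diff_right)
  qed
  have "(\<lambda>y. c \<bullet> y) ` V \<subseteq> (\<lambda>I. c \<bullet> (SOME y. y \<in> V \<and> J y = I)) ` Pow F"
  proof clarify
    fix y assume y: "y \<in> V"
    then have "(SOME z. z \<in> V \<and> J z = J y) \<in> V \<and> J (SOME z. z \<in> V \<and> J z = J y) = J y"
      by (intro someI[of "\<lambda>z. z \<in> V \<and> J z = J y" y]) simp
    then have "c \<bullet> y = c \<bullet> (SOME z. z \<in> V \<and> J z = J y)" using same y by metis
    moreover have "J y \<in> Pow F" by (auto simp: J_def)
    ultimately show "c \<bullet> y \<in> (\<lambda>I. c \<bullet> (SOME y. y \<in> V \<and> J y = I)) ` Pow F" by (rule image_eqI)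
  qed
  then have finV: "finite ((\<lambda>y. c \<bullet> y) ` V)" using fin finite_subset by blast
  have "V \<noteq> {}" using improve \<open>S \<noteq> {}\<close> by blast
  then have "Min ((\<lambda>y. c \<bullet> y) ` V) \<in> (\<lambda>y. c \<bullet> y) ` V" using finV by (intro Min_in) auto
  then obtain v where v: "v \<in> V" "c \<bullet> v = Min ((\<lambda>y. c \<bullet> y) ` V)" by auto
  show ?thesis
  proof (rule that)
    show "v \<in> S" using v by (simp add: V_def)
    fix x assume "x \<in> S"
    then obtain y where "y \<in> V" "c \<bullet> y \<le> c \<bullet> x" using improve by blast
    moreover have "c \<bullet> v \<le> c \<bullet> y" unfolding v(2) using finV \<open>y \<in> V\<close> by (intro Min_le) auto
    ultimately show "c \<bullet> v \<le> c \<bullet> x" by simp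
  qed
qed

section \<open>Sublevel sets of symmetric convex functions\<close>

text \<open>
  An unbounded sublevel set contains points with an arbitrarily large entry, which a permutation
  moves to any place. Averaging with the point that has all other entries negated leaves a multiple
  of a unit vector. Thus all coordinate axes lie in the set, and by convexity everything does.
\<close>
lemma sublevel_set_bounded_or_UNIV:
  fixes f :: "real^'n \<Rightarrow> real"
  assumes cvx: "convex_on UNIV f" and sym: "symmetric_fun f" and sgn: "sign_invariant f"
    and unb: "\<not> bounded {x. f x \<le> 0}"
  shows "f y \<le> 0"
proof -
  let ?C = "{x. f x \<le> 0}" and ?n = "real CARD('n)"
  have C: "convex ?C"
  proof (rule convexI)
    fix x z and a b :: real
    assume *: "x \<in> ?C" "z \<in> ?C" "0 \<le> a" "0 \<le> b" "a + b = 1"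
    then have "f (a *\<^sub>R x + b *\<^sub>R z) \<le> a * f x + b * f z"
      using cvx unfolding convex_on_def by blast
    also have "\<dots> \<le> 0" using * by (simp add: add_nonpos_nonpos mult_nonneg_nonpos)
    finally show "a *\<^sub>R x + b *\<^sub>R z \<in> ?C" by simp
  qed
  have flip: "f x = f z" if "\<And>i. \<bar>x $ i\<bar> = \<bar>z $ i\<bar>" for x z
  proof -
    have "f x = f (\<chi> i. \<bar>x $ i\<bar>)" "f z = f (\<chi> i. \<bar>z $ i\<bar>)"
      using sgn unfolding sign_invariant_def by blast+
    then show ?thesis by (simp add: that)
  qed
  have axis: "axis i t \<in> ?C" for i :: 'n and t
  proof -
    obtain x where x: "x \<in> ?C" "?n * \<bar>t\<bar> < norm x"
      using unb unfolding bounded_iff by (meson not_le)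
    have "\<exists>q. \<bar>t\<bar> < \<bar>x $ q\<bar>"
    proof (rule ccontr)
      assume "\<not> ?thesis"
      then have "(\<Sum>q\<in>UNIV. \<bar>x $ q\<bar>) \<le> (\<Sum>q\<in>(UNIV::'n set). \<bar>t\<bar>)" by (intro sum_mono) (auto simp: not_less)
      then show False using x(2) norm_le_l1_cart[of x] by simp
    qed
    then obtain q where q: "\<bar>t\<bar> < \<bar>x $ q\<bar>" ..
    define u where "u = (\<chi> r. x $ Transposition.transpose i q r)"
    have ui: "u $ i = x $ q" by (simp add: u_def)
    have "f u = f x"
      using sym permutes_swap_id[of i UNIV q] unfolding symmetric_fun_def u_def by blast
    then have u: "u \<in> ?C" using x(1) by simp
    have flipped: "f z = f u" if "\<And>r. \<bar>z $ r\<bar> = \<bar>u $ r\<bar>" for z using flip that by blast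
    have mid: "axis i e \<in> ?C" if e: "\<bar>e\<bar> = \<bar>u $ i\<bar>" for e
    proof -
      define v where "v = (\<chi> r. if r = i then e else u $ r)"
      define w where "w = (\<chi> r. if r = i then e else - u $ r)"
      have "v \<in> ?C" "w \<in> ?C" using flipped[of v] flipped[of w] e u by (auto simp: v_def w_def)
      then have "(1 - 1/2) *\<^sub>R v + (1/2) *\<^sub>R w \<in> ?C" by - (rule convexD_alt[OF C]; simp)
      moreover have "(1 - 1/2) *\<^sub>R v + (1/2) *\<^sub>R w = axis i e"
        by (simp add: vec_eq_iff v_def w_def axis_def)
      ultimately show ?thesis by simp
    qed
    define \<alpha> where "\<alpha> = (1 + t / \<bar>u $ i\<bar>) / 2"
    have \<alpha>: "0 \<le> \<alpha>" "\<alpha> \<le> 1" using q by (auto simp: \<alpha>_def ui field_simps abs_le_iff)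
    have "(1 - \<alpha>) *\<^sub>R axis i (- \<bar>u $ i\<bar>) + \<alpha> *\<^sub>R axis i \<bar>u $ i\<bar> \<in> ?C"
      using \<alpha> by (intro convexD_alt[OF C] mid) auto
    moreover have "(1 - \<alpha>) *\<^sub>R axis i (- \<bar>u $ i\<bar>) + \<alpha> *\<^sub>R axis i \<bar>u $ i\<bar> = axis i t"
      using q by (simp add: vec_eq_iff axis_def \<alpha>_def ui field_simps)
    ultimately show ?thesis by simp
  qed
  have "(\<Sum>i\<in>(UNIV::'n set). (1 / ?n) *\<^sub>R axis i (?n * y $ i)) \<in> ?C"
    by (rule convex_sum[OF _ C _ _ axis]) auto
  moreover have "(\<Sum>i\<in>(UNIV::'n set). (1 / ?n) *\<^sub>R axis i (?n * y $ i)) = y"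
    by (simp add: vec_eq_iff axis_def if_distrib[of "\<lambda>t. _ * t"] cong: if_cong)
  ultimately show ?thesis by simp
qed

lemma rank_outer_le: "rank (outer a b) \<le> 1"
proof -
  have "range ((*v) (outer a b)) \<subseteq> span {a}" by (auto simp: outer_mult intro: span_scale span_base)
  then have "dim (range ((*v) (outer a b))) \<le> card {a}" by (intro dim_le_card) auto
  then show ?thesis by (simp add: rank_dim_range)
qed

text \<open>
  Up to a common factor, every matrix is an average of matrices of rank at most one, and the factor
  can be moved into them.
\<close>
lemma convex_hull_domain_set_UNIV:
  fixes f :: "real^'n \<Rightarrow> real"
  assumes np: "CARD('n) \<le> CARD('p)" and k: "1 \<le> k" and f: "\<And>x. f x \<le> 0"
  shows "convex hull (domain_set f k :: (real^'p^'n) set) = UNIV"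
proof (intro set_eqI iffI UNIV_I)
  fix X :: "real^'p^'n"
  let ?n = "real CARD('n)"
  obtain s U V where X: "X = spectral_sum s U V" using svd[OF np] by metis
  have "(\<Sum>i\<in>UNIV. (1 / ?n) *\<^sub>R outer ((?n * s $ i) *\<^sub>R U $ i) (V $ i)) \<in> convex hull (domain_set f k)"
  proof (rule convex_sum[OF _ convex_convex_hull])
    fix i
    show "outer ((?n * s $ i) *\<^sub>R U $ i) (V $ i) \<in> convex hull (domain_set f k)"
      using rank_outer_le[of "(?n * s $ i) *\<^sub>R U $ i" "V $ i"] k f
      by (intro hull_inc) (simp add: domain_set_def)
  qed auto
  then show "X \<in> convex hull (domain_set f k)"
    by (simp add: X spectral_sum_def outer_scaleR_left)
qed

text \<open>
  The domain set is a continuous image of a compact set of triples \<open>(x, U, V)\<close>; this avoids a proof that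
  singular values depend continuously on the matrix.
\<close>
lemma compact_domain_set:
  fixes f :: "real^'n \<Rightarrow> real"
  assumes np: "CARD('n) \<le> CARD('p)" and sym: "symmetric_fun f" and sgn: "sign_invariant f"
    and cont: "continuous_on UNIV f" and bdd: "bounded {x. f x \<le> 0}"
  shows "compact (domain_set f k :: (real^'p^'n) set)"
proof -
  define C where "C = {x. f x \<le> 0 \<and> supported_within k x}"
  define K where "K = C \<times> {P :: real^'n^'n. orthonormal_rows P} \<times> {Q :: real^'p^'n. orthonormal_rows Q}"
  have "closed C"
    unfolding C_def supported_within_def
    by (intro closed_Collect_conj closed_Collect_le cont closed_Collect_all closed_Collect_imp
        closed_Collect_eq continuous_intros) simp
  moreover have "bounded C" using bdd by (rule bounded_subset) (auto simp: C_def)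
  ultimately have "compact C" by (simp add: compact_eq_bounded_closed)
  then have "compact K" unfolding K_def by (intro compact_Times compact_orthonormal_rows)
  then have "compact ((\<lambda>q. spectral_sum (fst q) (fst (snd q)) (snd (snd q))) ` K)"
    by (intro compact_continuous_image continuous_on_spectral_sum)
  moreover have "(\<lambda>q. spectral_sum (fst q) (fst (snd q)) (snd (snd q))) ` K = domain_set f k"
  proof
    show "(\<lambda>q. spectral_sum (fst q) (fst (snd q)) (snd (snd q))) ` K \<subseteq> domain_set f k"
      using spectral_sum_in_domain_set[OF sym sgn] by (auto simp: K_def C_def)
    show "domain_set f k \<subseteq> (\<lambda>q. spectral_sum (fst q) (fst (snd q)) (snd (snd q))) ` K"
    proof
      fix X :: "real^'p^'n" assume "X \<in> domain_set f k"
      then obtain s U V where *: "orthonormal_rows U" "orthonormal_rows V"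
        "X = spectral_sum s U V" "supported_within k s" "f s \<le> 0"
        using domain_set_svd[OF np sym sgn] by metis
      then have "(s, U, V) \<in> K" by (simp add: K_def C_def)
      then show "X \<in> (\<lambda>q. spectral_sum (fst q) (fst (snd q)) (snd (snd q))) ` K"
        using *(3) by (intro image_eqI[of _ _ "(s, U, V)"]) auto
    qed
  qed
  ultimately show ?thesis by simp
qed

section \<open>The rank bound\<close>

definition side_constraints ::
  "nat \<Rightarrow> (nat \<Rightarrow> 'a::euclidean_space) \<Rightarrow> (nat \<Rightarrow> ereal) \<Rightarrow> (nat \<Rightarrow> ereal) \<Rightarrow> 'a set" where
  "side_constraints m A bl bu = {X. \<forall>i\<in>{1..m}. bl i \<le> ereal (A i \<bullet> X) \<and> ereal (A i \<bullet> X) \<le> bu i}"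

lemma lsopr_feasible_eq:
  "lsopr_feasible f k m A bl bu = convex hull (domain_set f k) \<inter> side_constraints m A bl bu"
  by (auto simp: lsopr_feasible_def side_constraints_def)

text \<open>An infinite bound makes a constraint either void or unsatisfiable; both leave a polyhedron.\<close>
lemma polyhedron_side_constraints: "polyhedron (side_constraints m A bl bu)"
proof -
  have lower: "polyhedron {X. b \<le> ereal (a \<bullet> X)}" for a :: 'a and b
    by (cases b) (auto simp: polyhedron_halfspace_ge)
  have upper: "polyhedron {X. ereal (a \<bullet> X) \<le> b}" for a :: 'a and b
    by (cases b) (auto simp: polyhedron_halfspace_le)
  have "side_constraints m A bl bu =
      \<Inter>((\<lambda>i. {X. bl i \<le> ereal (A i \<bullet> X)} \<inter> {X. ereal (A i \<bullet> X) \<le> bu i}) ` {1..m})"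
    by (auto simp: side_constraints_def)
  also have "polyhedron \<dots>"
    using lower upper by (intro polyhedron_Inter) auto
  finally show ?thesis .
qed

lemma span_constraints_UNIV_if_no_line:
  fixes A :: "nat \<Rightarrow> 'a::euclidean_space"
  assumes "X \<in> side_constraints m A bl bu" and "\<not> contains_line (side_constraints m A bl bu)"
  shows "dim (A ` {1..m}) = DIM('a)"
proof (rule ccontr)
  assume "\<not> ?thesis"
  then have "dim (A ` {1..m}) < DIM('a)" using dim_subset_UNIV[of "A ` {1..m}"] by simp
  then obtain d where d: "d \<noteq> 0" "\<And>y. y \<in> span (A ` {1..m}) \<Longrightarrow> orthogonal d y"
    using orthogonal_to_subspace_exists by blast
  have "A i \<bullet> d = 0" if "i \<in> {1..m}" for i
    using d(2)[of "A i"] that by (simp add: span_base orthogonal_def inner_commute)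
  then have "X + t *\<^sub>R d \<in> side_constraints m A bl bu" for t
    using assms(1) by (simp add: side_constraints_def inner_add_right)
  then show False using assms(2) d(1) by (auto simp: contains_line_def)
qed

lemma rank_le_rows: "rank (X :: real^'p^'n) \<le> CARD('n)"
  using rank_bound[of X] by simp

text \<open>
  For optimal solutions, only the case of a bounded sublevel set needs an extreme point. If the
  sublevel set of \<open>f\<close> is unbounded and some point is feasible, \<open>mt\<close> is the number of matrix entries,
  and the bound allows every rank up to \<open>CARD('n)\<close>.
\<close>
theorem theorem4:
  fixes f :: "real^'n \<Rightarrow> real"
    and A :: "nat \<Rightarrow> real^'p^'n"
    and bl bu :: "nat \<Rightarrow> ereal"
    and k m kt mt :: nat
  assumes "1 \<le> k" and "k \<le> CARD('n)" and "CARD('n) \<le> CARD('p)"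
    and "continuous_on UNIV f" and "convex_on UNIV f"
    and "symmetric_fun f" and "sign_invariant f"
    and "\<And>i. i \<in> {1..m} \<Longrightarrow> bl i \<le> bu i"
    and "kt = strengthened_rank TYPE('p) f k"
    and "mt = dim (span (A ` {1..m}))"
    and "\<not> contains_line (lsopr_feasible f k m A bl bu)"
  shows "(\<forall>X. X extreme_point_of (lsopr_feasible f k m A bl bu) \<longrightarrow>
            int (rank X) \<le> int kt + \<lfloor>sqrt (2 * real mt + 9/4) - 3/2\<rfloor>) \<and>
         (\<bar>lsopr_value f k m A bl bu\<bar> \<noteq> \<infinity> \<longrightarrow>
            (\<exists>X. lsopr_optimal f k m A bl bu X \<and>
                 int (rank X) \<le> int kt + \<lfloor>sqrt (2 * real mt + 9/4) - 3/2\<rfloor>))"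
proof (intro conjI allI impI)
  let ?F = "lsopr_feasible f k m A bl bu"
  let ?B = "int kt + \<lfloor>sqrt (2 * real mt + 9/4) - 3/2\<rfloor>"
  show ext: "int (rank X) \<le> ?B" if "X extreme_point_of ?F" for X
    using rank_extreme_point[OF assms(1,3,5-7) that] assms(9,10) by simp
  have optimalI: "lsopr_optimal f k m A bl bu X"
    if "X \<in> ?F" "\<And>Y. Y \<in> ?F \<Longrightarrow> A 0 \<bullet> X \<le> A 0 \<bullet> Y" for X
    using that by (auto simp: lsopr_optimal_def is_arg_min_def not_less)
  assume "\<bar>lsopr_value f k m A bl bu\<bar> \<noteq> \<infinity>"
  then obtain v where v: "lsopr_value f k m A bl bu = ereal v" by auto
  then have ne: "?F \<noteq> {}" by (auto simp: lsopr_value_def top_ereal_def)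
  have lower: "v \<le> A 0 \<bullet> X" if "X \<in> ?F" for X
    using INF_lower[OF that, of "\<lambda>X. ereal (A 0 \<bullet> X)"] v by (simp add: lsopr_value_def)
  show "\<exists>X. lsopr_optimal f k m A bl bu X \<and> int (rank X) \<le> ?B"
  proof (cases "bounded {x. f x \<le> 0}")
    case True
    have "compact (convex hull (domain_set f k :: (real^'p^'n) set))"
      by (intro compact_convex_hull compact_domain_set assms True)
    then have comp: "compact ?F" unfolding lsopr_feasible_eq
      by (rule compact_Int_closed) (rule polyhedron_imp_closed[OF polyhedron_side_constraints])
    have conv: "convex ?F" unfolding lsopr_feasible_eq
      by (intro convex_Int convex_convex_hull polyhedron_imp_convex[OF polyhedron_side_constraints])
    have "continuous_on ?F (\<lambda>X. A 0 \<bullet> X)" by (intro continuous_intros)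
    then obtain Y where Y: "Y \<in> ?F" "\<And>Z. Z \<in> ?F \<Longrightarrow> A 0 \<bullet> Y \<le> A 0 \<bullet> Z"
      using continuous_attains_inf[OF comp ne] by blast
    define G where "G = ?F \<inter> {X. A 0 \<bullet> X = A 0 \<bullet> Y}"
    have face: "G face_of ?F"
      unfolding G_def using Y(2) by (intro face_of_Int_supporting_hyperplane_ge conv) auto
    have "compact G" unfolding G_def by (intro compact_Int_closed comp closed_hyperplane)
    moreover have "convex G" using face by (rule face_of_imp_convex)
    moreover have "G \<noteq> {}" using Y by (auto simp: G_def)
    ultimately obtain X where "X extreme_point_of G" by (rule extreme_point_exists_convex)
    then have X: "X extreme_point_of ?F" "X \<in> G" using extreme_point_of_face[OF face] by auto
    have "lsopr_optimal f k m A bl bu X"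
      using X(2) Y(2) by (intro optimalI) (auto simp: G_def)
    then show ?thesis using ext[OF X(1)] by blast
  next
    case False
    then have f: "f x \<le> 0" for x by (rule sublevel_set_bounded_or_UNIV[OF assms(5-7)])
    have F: "?F = side_constraints m A bl bu"
      by (simp add: lsopr_feasible_eq convex_hull_domain_set_UNIV[OF assms(3,1) f])
    have "polyhedron ?F" unfolding F by (rule polyhedron_side_constraints)
    then obtain X where X: "X \<in> ?F" "\<And>Y. Y \<in> ?F \<Longrightarrow> A 0 \<bullet> X \<le> A 0 \<bullet> Y"
      using linear_attains_min_on_polyhedron[OF _ ne lower] by metis
    have "dim (A ` {1..m}) = DIM(real^'p^'n)"
      using X(1) assms(11) unfolding F by (rule span_constraints_UNIV_if_no_line)
    then have mt: "mt = CARD('n) * CARD('p)" using assms(10) by simp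
    define s where "s = CARD('n) - 1"
    have n: "CARD('n) = Suc s" by (simp add: s_def)
    have "s * (s + 3) \<le> 2 * (Suc s * Suc s)" by (simp add: algebra_simps)
    also have "\<dots> \<le> 2 * mt" unfolding mt n[symmetric] using assms(3) by simp
    finally have "int s \<le> \<lfloor>sqrt (2 * real mt + 9/4) - 3/2\<rfloor>" by (rule le_floor_sqrt_bound)
    moreover have "rank X \<le> kt + s"
      using rank_le_rows[of X] strengthened_rank_properties(1)[OF assms(1), of f, where 'p='p] assms(9)
      by (simp add: s_def)
    ultimately show ?thesis using optimalI[OF X] by force
  qed
qed

end
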